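(* Let $G^\sigma$ be a signed complete graph (underlying graph $K_n$) whose adjacency matrix has all but at most two eigenvalues (counted with multiplicity) equal to $\pm 1$. Then $G^\sigma$ is determined by its spectrum up to switching: every signed graph whose adjacency matrix has the same spectrum as that of $G^\sigma$ is switching isomorphic with $G^\sigma$.
   Context: A signed graph $G^\sigma$ is a finite simple graph $G$ with a signature $\sigma:E(G)\to\{-1,+1\}$; its adjacency matrix has entry $\sigma(\{u,v\})$ for edges and $0$ otherwise, and its spectrum is the multiset of eigenvalues of this matrix. Switching with respect to a vertex subset $X$ changes the sign of every edge between $X$ and $V\setminus X$; two signed graphs are switching isomorphic if one can be switched into an isomorphic copy of the other. *)

theory Defs
  imports "Jordan_Normal_Form.Char_Poly" "HOL-Computational_Algebra.Fundamental_Theorem_Algebra"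
begin

record 'a sgraph =
  verts :: "'a set"
  edges :: "'a set set"
  sgn_of :: "'a set \<Rightarrow> int"

definition all_pairs :: "'a set \<Rightarrow> 'a set set" where
  "all_pairs V = {e. e \<subseteq> V \<and> card e = 2}"

text \<open>Values of the signature outside the edge set are irrelevant.\<close>

definition signed_graph :: "'a sgraph \<Rightarrow> bool" where
  "signed_graph G \<longleftrightarrow> finite (verts G) \<and> edges G \<subseteq> all_pairs (verts G) \<and>
     (\<forall>e\<in>edges G. sgn_of G e \<in> {-1, 1})"

definition signed_complete_graph :: "'a sgraph \<Rightarrow> bool" where
  "signed_complete_graph G \<longleftrightarrow> signed_graph G \<and> edges G = all_pairs (verts G)"

definition adj :: "'a sgraph \<Rightarrow> 'a \<Rightarrow> 'a \<Rightarrow> int" where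
  "adj G u v = (if {u, v} \<in> edges G then sgn_of G {u, v} else 0)"

definition sadj_mat :: "'a sgraph \<Rightarrow> 'a list \<Rightarrow> complex mat" where
  "sadj_mat G vs = mat (length vs) (length vs) (\<lambda>(i, j). of_int (adj G (vs ! i) (vs ! j)))"

text \<open>The spectrum is the multiset of complex roots of the characteristic polynomial of the
  adjacency matrix (which is real symmetric, so they are all real), for some enumeration of the
  vertices; by \<open>sg_spectrum_eq\<close> below every enumeration gives the same multiset.\<close>

definition sg_spectrum :: "'a sgraph \<Rightarrow> complex multiset" where
  "sg_spectrum G = proots (char_poly (sadj_mat G (SOME vs. distinct vs \<and> set vs = verts G)))"

definition switch :: "'a set \<Rightarrow> 'a sgraph \<Rightarrow> 'a sgraph" where
  "switch X G = G\<lparr>sgn_of := (\<lambda>e. if e \<inter> X \<noteq> {} \<and> e \<inter> (verts G - X) \<noteq> {}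
                               then - sgn_of G e else sgn_of G e)\<rparr>"

definition sg_isomorphic :: "'a sgraph \<Rightarrow> 'b sgraph \<Rightarrow> bool" where
  "sg_isomorphic G H \<longleftrightarrow> (\<exists>f. bij_betw f (verts G) (verts H) \<and>
     edges H = (\<lambda>e. f ` e) ` edges G \<and> (\<forall>e\<in>edges G. sgn_of H (f ` e) = sgn_of G e))"

definition switching_isomorphic :: "'a sgraph \<Rightarrow> 'b sgraph \<Rightarrow> bool" where
  "switching_isomorphic G H \<longleftrightarrow> (\<exists>X \<subseteq> verts G. sg_isomorphic (switch X G) H)"

lemma char_poly_sadj_mat_enum:
  assumes vs: "distinct vs" and ws: "distinct ws" and eq: "set vs = set ws"
  shows "char_poly (sadj_mat G vs) = char_poly (sadj_mat G ws)"
proof (rule char_poly_similar)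
  define n where "n = length vs"
  have n: "length vs = n" "length ws = n"
    using distinct_card[OF vs] distinct_card[OF ws] eq by (simp_all add: n_def)
  define P :: "complex mat" where "P = mat n n (\<lambda>(i, j). if vs ! i = ws ! j then 1 else 0)"
  define Q :: "complex mat" where "Q = mat n n (\<lambda>(i, j). if ws ! i = vs ! j then 1 else 0)"
  have sel: "(\<Sum>k = 0..<n. (if x = us ! k then 1 else 0) * h (us ! k)) = h x"
    "(\<Sum>k = 0..<n. h (us ! k) * (if us ! k = x then 1 else 0)) = h x"
    if us: "distinct us" "length us = n" "x \<in> set us" for us :: "'a list" and x and h :: "'a \<Rightarrow> complex"
  proof -
    obtain m where m: "m < n" "us ! m = x"
      using us(2,3) by (metis in_set_conv_nth)
    have *: "us ! k = x \<longleftrightarrow> k = m" if "k < n" for k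
      using nth_eq_iff_index_eq[OF \<open>distinct us\<close>, of k m] that m \<open>length us = n\<close> by simp
    have "(\<Sum>k = 0..<n. h (us ! k) * (if us ! k = x then 1 else 0)) =
          (\<Sum>k = 0..<n. if k = m then h x else 0)"
    proof (rule sum.cong)
      fix k assume "k \<in> {0..<n}"
      then show "h (us ! k) * (if us ! k = x then 1 else 0) = (if k = m then h x else 0)"
        using *[of k] m(2) by auto
    qed simp
    then show 2: "(\<Sum>k = 0..<n. h (us ! k) * (if us ! k = x then 1 else 0)) = h x"
      using m(1) by simp
    have "(\<Sum>k = 0..<n. (if x = us ! k then 1 else 0) * h (us ! k)) =
          (\<Sum>k = 0..<n. h (us ! k) * (if us ! k = x then 1 else 0))"
    proof (rule sum.cong)
      fix k
      show "(if x = us ! k then 1 else 0) * h (us ! k) = h (us ! k) * (if us ! k = x then 1 else 0)"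
        by (cases "x = us ! k") simp_all
    qed simp
    then show "(\<Sum>k = 0..<n. (if x = us ! k then 1 else 0) * h (us ! k)) = h x"
      using 2 by simp
  qed
  have mem: "vs ! i \<in> set ws" "ws ! i \<in> set vs" if "i < n" for i
    using that n nth_mem[of i vs] nth_mem[of i ws] eq by simp_all
  have PQ: "P * Q = 1\<^sub>m n"
  proof (rule eq_matI)
    fix i j assume "i < dim_row (1\<^sub>m n :: complex mat)" "j < dim_col (1\<^sub>m n :: complex mat)"
    then have ij: "i < n" "j < n" by auto
    then have "(P * Q) $$ (i, j) =
        (\<Sum>k = 0..<n. (if vs ! i = ws ! k then 1 else 0) * (if ws ! k = vs ! j then 1 else 0))"
      by (simp add: P_def Q_def scalar_prod_def)
    also have "\<dots> = (if vs ! i = vs ! j then 1 else 0)"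
      using sel(1)[OF ws n(2) mem(1)[OF ij(1)], where h = "\<lambda>y. if y = vs ! j then 1 else 0"] .
    finally show "(P * Q) $$ (i, j) = 1\<^sub>m n $$ (i, j)"
      using ij vs n by (simp add: nth_eq_iff_index_eq)
  qed (auto simp: P_def Q_def)
  have QP: "Q * P = 1\<^sub>m n"
  proof (rule eq_matI)
    fix i j assume "i < dim_row (1\<^sub>m n :: complex mat)" "j < dim_col (1\<^sub>m n :: complex mat)"
    then have ij: "i < n" "j < n" by auto
    then have "(Q * P) $$ (i, j) =
        (\<Sum>k = 0..<n. (if ws ! i = vs ! k then 1 else 0) * (if vs ! k = ws ! j then 1 else 0))"
      by (simp add: P_def Q_def scalar_prod_def)
    also have "\<dots> = (if ws ! i = ws ! j then 1 else 0)"
      using sel(1)[OF vs n(1) mem(2)[OF ij(1)], where h = "\<lambda>y. if y = ws ! j then 1 else 0"] .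
    finally show "(Q * P) $$ (i, j) = 1\<^sub>m n $$ (i, j)"
      using ij ws n by (simp add: nth_eq_iff_index_eq)
  qed (auto simp: P_def Q_def)
  have PB: "(P * sadj_mat G ws) $$ (i, k) = of_int (adj G (vs ! i) (ws ! k))"
    if "i < n" "k < n" for i k
  proof -
    have "(P * sadj_mat G ws) $$ (i, k) =
        (\<Sum>l = 0..<n. (if vs ! i = ws ! l then 1 else 0) * of_int (adj G (ws ! l) (ws ! k)))"
      using that n by (simp add: P_def sadj_mat_def scalar_prod_def)
    also have "\<dots> = of_int (adj G (vs ! i) (ws ! k))"
      using sel(1)[OF ws n(2) mem(1)[OF that(1)], where h = "\<lambda>y. of_int (adj G y (ws ! k))"] .
    finally show ?thesis .
  qed
  have "sadj_mat G vs = P * sadj_mat G ws * Q"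
  proof (rule eq_matI)
    fix i j assume "i < dim_row (P * sadj_mat G ws * Q)" "j < dim_col (P * sadj_mat G ws * Q)"
    then have ij: "i < n" "j < n" by (auto simp: P_def Q_def)
    have "(P * sadj_mat G ws * Q) $$ (i, j) =
        (\<Sum>k = 0..<n. (P * sadj_mat G ws) $$ (i, k) * Q $$ (k, j))"
      using ij n by (simp add: P_def Q_def sadj_mat_def scalar_prod_def)
    also have "\<dots> = (\<Sum>k = 0..<n. of_int (adj G (vs ! i) (ws ! k)) * (if ws ! k = vs ! j then 1 else 0))"
      using ij by (intro sum.cong) (auto simp: PB Q_def)
    also have "\<dots> = of_int (adj G (vs ! i) (vs ! j))"
      using sel(2)[OF ws n(2) mem(1)[OF ij(2)], where h = "\<lambda>y. of_int (adj G (vs ! i) y)"] .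
    finally show "sadj_mat G vs $$ (i, j) = (P * sadj_mat G ws * Q) $$ (i, j)"
      using ij n by (simp add: sadj_mat_def)
  qed (auto simp: P_def Q_def sadj_mat_def n)
  then show "similar_mat (sadj_mat G vs) (sadj_mat G ws)"
    by (intro similar_matI[OF _ PQ QP]) (auto simp: P_def Q_def sadj_mat_def n)
qed

lemma sg_spectrum_eq:
  assumes "distinct vs" and "set vs = verts G"
  shows "sg_spectrum G = proots (char_poly (sadj_mat G vs))"
proof -
  have "distinct (SOME vs. distinct vs \<and> set vs = verts G) \<and>
        set (SOME vs. distinct vs \<and> set vs = verts G) = verts G"
    using assms by (intro someI) blast
  then have "char_poly (sadj_mat G (SOME vs. distinct vs \<and> set vs = verts G)) =
      char_poly (sadj_mat G vs)"
    using assms by (intro char_poly_sadj_mat_enum) auto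
  then show ?thesis
    by (simp only: sg_spectrum_def)
qed

end

theory Submission
  imports Defs "Jordan_Normal_Form.Schur_Decomposition"
begin

text \<open>Comparing traces of squares shows that a cospectral mate of a signed complete graph is
  complete, so it suffices to classify the signed complete graphs in question and to separate them
  by their spectra. If at most two eigenvalues differ from \<open>\<plusminus>1\<close>, then either all eigenvalues are
  at most 1, or all are at least \<open>-1\<close>, or at most one exceeds 1 and at most one is below \<open>-1\<close>.
  Switch so that a fixed vertex \<open>v\<close> has only positive edges, and look at the graph of negative edges
  on the other vertices. In the first two cases it is complete or empty. In the third case
  interlacing excludes the induced subgraphs \<open>2K\<^sub>2\<close>, \<open>C\<^sub>4\<close>, \<open>P\<^sub>4\<close>, \<open>P\<^sub>3 + K\<^sub>1\<close> and the paw, which forces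
  the graph or its complement to be a clique with isolated vertices. In every case the signed graph
  is, up to switching, positive except for a negative clique on a set \<open>S\<close>, and one may take
  \<open>1 \<le> |S| \<le> n - 1\<close>. On this range the trace of the cube of the adjacency matrix is strictly
  decreasing in \<open>|S|\<close>, so the spectrum determines \<open>|S|\<close>.\<close>

section \<open>Unitary diagonalization of Hermitian matrices\<close>

lemma mat_adjoint_dim [simp]:
  "dim_row (mat_adjoint A) = dim_col A" "dim_col (mat_adjoint A) = dim_row A"
  by (simp_all add: mat_adjoint_def)

lemma mat_adjoint_carrier [simp]:
  "A \<in> carrier_mat n m \<Longrightarrow> mat_adjoint A \<in> carrier_mat m n"
  by (intro carrier_matI) auto

lemma mat_adjoint_index [simp]:
  "i < dim_col A \<Longrightarrow> j < dim_row A \<Longrightarrow> mat_adjoint A $$ (i, j) = conjugate (A $$ (j, i))"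
  by (simp add: mat_adjoint_def mat_of_rows_index)

lemma mat_adjoint_mult:
  fixes A B :: "complex mat"
  assumes "A \<in> carrier_mat n m" "B \<in> carrier_mat m k"
  shows "mat_adjoint (A * B) = mat_adjoint B * mat_adjoint A"
  using assms by (intro eq_matI) (auto simp: scalar_prod_def mult.commute)

lemma mat_adjoint_adjoint [simp]: "mat_adjoint (mat_adjoint A) = A"
  by (intro eq_matI) auto

lemma mat_adjoint_four_block:
  assumes "A \<in> carrier_mat n1 m1" "B \<in> carrier_mat n1 m2" "C \<in> carrier_mat n2 m1" "D \<in> carrier_mat n2 m2"
  shows "mat_adjoint (four_block_mat A B C D) =
    four_block_mat (mat_adjoint A) (mat_adjoint C) (mat_adjoint B) (mat_adjoint D)"
  using assms by (intro eq_matI) auto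

lemma mat_adjoint_zero [simp]: "mat_adjoint (0\<^sub>m n m) = 0\<^sub>m m n"
  by (intro eq_matI) auto

lemma mat_adjoint_one [simp]: "mat_adjoint (1\<^sub>m n :: complex mat) = 1\<^sub>m n"
  by (intro eq_matI) auto

lemma mult_block_diagonal:
  fixes A1 :: "complex mat"
  assumes "A1 \<in> carrier_mat n n" "A2 \<in> carrier_mat n n" "D1 \<in> carrier_mat m m" "D2 \<in> carrier_mat m m"
  shows "four_block_mat A1 (0\<^sub>m n m) (0\<^sub>m m n) D1 * four_block_mat A2 (0\<^sub>m n m) (0\<^sub>m m n) D2 =
    four_block_mat (A1 * A2) (0\<^sub>m n m) (0\<^sub>m m n) (D1 * D2)"
  using assms mult_carrier_mat[OF assms(1,2)] mult_carrier_mat[OF assms(3,4)]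
  by (subst mult_four_block_mat[of _ n n _ m _ m _ _ n _ m])
    (auto simp: left_mult_zero_mat[of _ _ n] left_mult_zero_mat[of _ _ m]
      right_mult_zero_mat[of _ _ n] right_mult_zero_mat[of _ _ m])

text \<open>Gram-Schmidt applied to a completion of \<open>v\<close> to a basis keeps
  \<open>v\<close> in front. Its output is orthogonal but not normalized, so every vector is divided
  by its norm; this is where the factor \<open>c\<close> comes from.\<close>

lemma unitary_with_first_column:
  fixes v :: "complex vec"
  assumes v: "v \<in> carrier_vec n" "v \<noteq> 0\<^sub>v n"
  obtains W c where "W \<in> carrier_mat n n" "mat_adjoint W * W = 1\<^sub>m n" "W * mat_adjoint W = 1\<^sub>m n"
    "col W 0 = c \<cdot>\<^sub>v v"
proof -
  interpret cof_vec_space n "TYPE(complex)" .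
  define b where "b = basis_completion v"
  define ws where "ws = gram_schmidt n b"
  note bc = basis_completion[OF v, folded b_def]
  have n: "n \<noteq> 0" using v by (auto intro!: eq_vecI)
  have ws: "set ws \<subseteq> carrier_vec n" "corthogonal ws" "length ws = n"
    using gram_schmidt_result[OF bc(2) bc(4) bc(5) refl, folded ws_def] bc(6) by auto
  obtain vs where "b = v # vs" using bc(6,7) n by (cases b) auto
  then have "hd ws = v" using gram_schmidt_hd[OF v(1), of vs] by (simp add: ws_def)
  then have ws0: "ws ! 0 = v" using ws(3) n by (metis hd_conv_nth list.size(3))
  define c where "c i = complex_of_real (1 / sqrt (Re (ws ! i \<bullet>c ws ! i)))" for i
  define W where "W = mat n n (\<lambda>(i, j). c j * ws ! j $ i)"
  have W: "W \<in> carrier_mat n n" by (simp add: W_def)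
  have car: "ws ! i \<in> carrier_vec n" if "i < n" for i using ws that by auto
  have cc: "cnj (c i) * c i * (ws ! i \<bullet>c ws ! i) = 1" if i: "i < n" for i
  proof -
    have "ws ! i \<bullet>c ws ! i \<ge> 0" by (rule conjugate_square_ge_0_vec)
    moreover have "ws ! i \<bullet>c ws ! i \<noteq> 0" using corthogonalD[OF ws(2)] i ws(3) by auto
    ultimately obtain x where x: "ws ! i \<bullet>c ws ! i = complex_of_real x" "x > 0"
      by (metis complex_is_Real_iff less_eq_complex_def of_real_Re of_real_eq_0_iff order_le_less zero_complex.simps)
    then have "sqrt x * sqrt x = x" by simp
    then show ?thesis using x unfolding c_def x(1)
      by (simp flip: of_real_mult of_real_divide)
  qed
  have WW: "mat_adjoint W * W = 1\<^sub>m n"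
  proof (rule eq_matI)
    fix i j assume "i < dim_row (1\<^sub>m n :: complex mat)" "j < dim_col (1\<^sub>m n :: complex mat)"
    then have ij: "i < n" "j < n" by auto
    have "(mat_adjoint W * W) $$ (i, j) = cnj (c i) * c j * (ws ! j \<bullet>c ws ! i)"
      using ij W car[OF ij(1)] car[OF ij(2)]
      by (auto simp: scalar_prod_def W_def sum_distrib_left intro!: sum.cong)
    also have "\<dots> = (if i = j then 1 else 0)"
      using cc[OF ij(1)] corthogonalD[OF ws(2), of j i] ij ws(3) by auto
    finally show "(mat_adjoint W * W) $$ (i, j) = 1\<^sub>m n $$ (i, j)" using ij by simp
  qed (use W in auto)
  have "W * mat_adjoint W = 1\<^sub>m n"
    using mat_mult_left_right_inverse[OF mat_adjoint_carrier[OF W] W WW] .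
  moreover have "col W 0 = c 0 \<cdot>\<^sub>v v"
    using n v(1) by (intro eq_vecI) (auto simp: W_def ws0)
  ultimately show ?thesis using that W WW by blast
qed

text \<open>Deflation, by induction on the list of roots: in a unitary basis that starts with an
  eigenvector the matrix splits into the eigenvalue and a smaller Hermitian block. Fixing
  \<open>es\<close> in advance keeps track of multiplicities; that its entries are real is derived
  in \<open>symmetric_spectral_decomposition\<close>.\<close>

theorem hermitian_unitary_diagonalization:
  fixes A :: "complex mat"
  assumes "A \<in> carrier_mat n n" "mat_adjoint A = A" "char_poly A = (\<Prod>e\<leftarrow>es. [:- e, 1:])"
  shows "\<exists>U. U \<in> carrier_mat n n \<and> mat_adjoint U * U = 1\<^sub>m n \<and>
    A = U * mat_diag n (\<lambda>i. es ! i) * mat_adjoint U"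
  using assms
proof (induction es arbitrary: n A)
  case Nil
  then have "n = 0" using degree_monic_char_poly[of A n] by simp
  then show ?case using Nil by (intro exI[of _ "1\<^sub>m 0"]) (auto intro!: eq_matI)
next
  case (Cons e es n A)
  note A = Cons.prems(1)
  note assoc = assoc_mult_mat[of _ n n _ n _ n] mult_carrier_mat[of _ n n _ n]
  have cp: "char_poly A = [:- e, 1:] * (\<Prod>e\<leftarrow>es. [:- e, 1:])" using Cons.prems(3) by simp
  have "eigenvalue A e" unfolding eigenvalue_root_char_poly[OF A] cp by simp
  then obtain v where v: "v \<in> carrier_vec n" "v \<noteq> 0\<^sub>v n" and Av: "A *\<^sub>v v = e \<cdot>\<^sub>v v"
    using A unfolding eigenvalue_def eigenvector_def by auto
  obtain W c where W: "W \<in> carrier_mat n n" and WW: "mat_adjoint W * W = 1\<^sub>m n" "W * mat_adjoint W = 1\<^sub>m n"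
    and W0: "col W 0 = c \<cdot>\<^sub>v v"
    using unitary_with_first_column[OF v] by blast
  have n: "n \<noteq> 0" using v by (auto intro!: eq_vecI)
  define m where "m = n - 1"
  have nm: "n = Suc m" using n by (simp add: m_def)
  note W' = mat_adjoint_carrier[OF W]
  define B where "B = mat_adjoint W * A * W"
  have B: "B \<in> carrier_mat n n" unfolding B_def using W W' A by (metis mult_carrier_mat)
  have BH: "mat_adjoint B = B"
    unfolding B_def using W W' A
    by (simp add: mat_adjoint_mult[of _ n n _ n] assoc Cons.prems(2))
  have "A = 1\<^sub>m n * A * 1\<^sub>m n" using A by simp
  also have "\<dots> = W * B * mat_adjoint W"
    unfolding WW(2)[symmetric] B_def using W W' A by (simp add: assoc)
  finally have AB: "A = W * B * mat_adjoint W" .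
  \<comment> \<open>The first column of \<open>W\<close> is an eigenvector of \<open>A\<close>, so
    the first column of \<open>B\<close> is \<open>e\<close> times the first unit vector. Being
    Hermitian, \<open>B\<close> then also has a first row that vanishes outside the corner.\<close>
  have "col B 0 = mat_adjoint W *\<^sub>v (A *\<^sub>v col W 0)"
    unfolding B_def assoc_mult_mat[OF W' A W]
    using col_mult2[OF W' mult_carrier_mat[OF A W], of 0] col_mult2[OF A W, of 0] n by (metis neq0_conv)
  also have "A *\<^sub>v col W 0 = e \<cdot>\<^sub>v col W 0"
    using A v unfolding W0 by (simp add: mult_mat_vec[of _ n n] Av smult_smult_assoc mult.commute)
  also have "mat_adjoint W *\<^sub>v (e \<cdot>\<^sub>v col W 0) = e \<cdot>\<^sub>v col (mat_adjoint W * W) 0"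
    using W W' n by (simp add: mult_mat_vec[of _ n n] col_mult2[of _ n n _ n])
  finally have "col B 0 = e \<cdot>\<^sub>v col (1\<^sub>m n) 0" using WW by simp
  then have col0: "B $$ (i, 0) = (if i = 0 then e else 0)" if "i < n" for i
    using that n B by (auto dest!: arg_cong[of _ _ "\<lambda>v. v $ i"])
  have herm0: "B $$ (0, i) = conjugate (B $$ (i, 0))" if "i < n" for i
    using that n B by (subst BH[symmetric]) auto
  have row0: "B $$ (0, i) = (if i = 0 then e else 0)" if "i < n" for i
    using col0[OF that] herm0[OF that] by (cases "i = 0") simp_all
  define C where "C = mat m m (\<lambda>(i, j). B $$ (Suc i, Suc j))"
  define E where "E = mat 1 1 (\<lambda>_. e)"
  have C: "C \<in> carrier_mat m m" and E: "E \<in> carrier_mat 1 1" by (simp_all add: C_def E_def)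
  have Bblk: "B = four_block_mat E (0\<^sub>m 1 m) (0\<^sub>m m 1) C"
    using B col0 row0 nm by (intro eq_matI) (auto simp: C_def E_def)
  have CH: "mat_adjoint C = C"
  proof (rule eq_matI)
    fix i j assume "i < dim_row C" "j < dim_col C"
    then have ij: "i < m" "j < m" by (auto simp: C_def)
    have "B $$ (Suc i, Suc j) = conjugate (B $$ (Suc j, Suc i))"
      using ij nm B by (subst BH[symmetric]) auto
    then show "mat_adjoint C $$ (i, j) = C $$ (i, j)" using ij by (simp add: C_def)
  qed (auto simp: C_def)
  have "similar_mat A B"
    by (rule similar_matI[of _ _ W "mat_adjoint W" n]) (use A B W W' WW AB in auto)
  \<comment> \<open>Cancelling the factor of \<open>e\<close> leaves exactly the remaining roots for
    \<open>C\<close>, as the induction hypothesis requires.\<close>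
  then have "char_poly E * char_poly C = [:- e, 1:] * (\<Prod>e\<leftarrow>es. [:- e, 1:])"
    using char_poly_similar[of A B] char_poly_four_block_zeros_col[OF E zero_carrier_mat C]
    unfolding Bblk cp by metis
  moreover have "char_poly E = [:- e, 1:]"
    by (simp add: E_def char_poly_defs det_def sign_def)
  ultimately have "char_poly C = (\<Prod>e\<leftarrow>es. [:- e, 1:])"
    by (metis mult_cancel_left pCons_eq_0_iff zero_neq_one)
  from Cons.IH[OF C CH this] obtain V where V: "V \<in> carrier_mat m m" and VV: "mat_adjoint V * V = 1\<^sub>m m"
    and CV: "C = V * mat_diag m (\<lambda>i. es ! i) * mat_adjoint V" by auto
  define V1 where "V1 = four_block_mat (1\<^sub>m 1) (0\<^sub>m 1 m) (0\<^sub>m m 1) V"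
  note V' = mat_adjoint_carrier[OF V]
  have V1: "V1 \<in> carrier_mat n n" using V nm by (intro carrier_matI) (auto simp: V1_def)
  have V1a: "mat_adjoint V1 = four_block_mat (1\<^sub>m 1) (0\<^sub>m 1 m) (0\<^sub>m m 1) (mat_adjoint V)"
    unfolding V1_def using V by (subst mat_adjoint_four_block[of _ 1 1 _ m _ m]) auto
  have D: "mat_diag n (\<lambda>i. (e # es) ! i) =
      four_block_mat E (0\<^sub>m 1 m) (0\<^sub>m m 1) (mat_diag m (\<lambda>i. es ! i))"
    by (rule eq_matI) (auto simp: nm mat_diag_def E_def nth_Cons')
  have BV: "B = V1 * mat_diag n (\<lambda>i. (e # es) ! i) * mat_adjoint V1"
    unfolding D V1a unfolding V1_def Bblk CV
    using mult_block_diagonal[OF _ E V mat_diag_dim, of "1\<^sub>m 1" "(!) es"]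
      mult_block_diagonal[OF E _ mult_carrier_mat[OF V mat_diag_dim] V', of "1\<^sub>m 1" "(!) es"] E by simp
  have VV1: "mat_adjoint V1 * V1 = 1\<^sub>m n"
    unfolding V1a unfolding V1_def using mult_block_diagonal[OF _ _ V' V, of "1\<^sub>m 1" 1 "1\<^sub>m 1"] VV nm
    by (auto intro!: eq_matI)
  note V1' = mat_adjoint_carrier[OF V1]
  have "mat_adjoint (W * V1) * (W * V1) = mat_adjoint V1 * (mat_adjoint W * W) * V1"
    using W W' V1 V1' by (simp add: mat_adjoint_mult[of _ n n _ n] assoc)
  then have "mat_adjoint (W * V1) * (W * V1) = 1\<^sub>m n" using WW VV1 right_mult_one_mat[OF V1'] by simp
  moreover have "A = W * V1 * mat_diag n (\<lambda>i. (e # es) ! i) * mat_adjoint (W * V1)"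
    unfolding AB BV using W W' V1 V1'
    by (simp add: mat_adjoint_mult[of _ n n _ n] assoc)
  ultimately show ?case using W V1 by (intro exI[of _ "W * V1"]) auto
qed

section \<open>Signed cliques with one eigenvalue above 1 and one below -1\<close>

definition bform :: "'v set \<Rightarrow> ('v \<Rightarrow> 'v \<Rightarrow> real) \<Rightarrow> ('v \<Rightarrow> real) \<Rightarrow> ('v \<Rightarrow> real) \<Rightarrow> real" where
  "bform V b x y = (\<Sum>u\<in>V. \<Sum>v\<in>V. x u * b u v * y v)"

text \<open>The vectors \<open>x\<close> and \<open>y\<close> are an orthogonal basis of a plane on which \<open>b\<close> is positive
  definite; \<open>two_positive V (shift c a)\<close> says that \<open>c * a\<close> has two eigenvalues above 1.\<close>

definition two_positive :: "'v set \<Rightarrow> ('v \<Rightarrow> 'v \<Rightarrow> real) \<Rightarrow> bool" where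
  "two_positive V b \<longleftrightarrow> (\<exists>x y. bform V b x y = 0 \<and> bform V b x x > 0 \<and> bform V b y y > 0)"

text \<open>Positive directions come from eigenvalues of \<open>a\<close> above 1 when
  \<open>c = 1\<close> and below -1 when \<open>c = -1\<close>, so one argument serves both ends of
  the spectrum.\<close>

definition shift :: "real \<Rightarrow> ('v \<Rightarrow> 'v \<Rightarrow> real) \<Rightarrow> 'v \<Rightarrow> 'v \<Rightarrow> real" where
  "shift c a u v = c * a u v - (if u = v then 1 else 0)"

text \<open>Extension by zero of a short coordinate list: it turns a form over an arbitrary finite
  vertex set into an explicit double sum over list positions.\<close>

definition supported :: "'v list \<Rightarrow> real list \<Rightarrow> 'v \<Rightarrow> real" where
  "supported ws xs u = (\<Sum>i<length ws. if u = ws ! i then xs ! i else 0)"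

lemma supported_nth:
  assumes "distinct ws" "j < length ws"
  shows "supported ws xs (ws ! j) = xs ! j"
proof -
  have "supported ws xs (ws ! j) = (\<Sum>i<length ws. if i = j then xs ! i else 0)"
    unfolding supported_def using assms by (intro sum.cong) (auto simp: nth_eq_iff_index_eq)
  then show ?thesis using assms by simp
qed

lemma supported_outside: "u \<notin> set ws \<Longrightarrow> supported ws xs u = 0"
  unfolding supported_def by (intro sum.neutral) auto

lemma bform_supported:
  assumes V: "finite V" "set ws \<subseteq> V" "distinct ws"
  shows "bform V b (supported ws xs) (supported ws ys) =
    (\<Sum>i<length ws. \<Sum>j<length ws. xs ! i * b (ws ! i) (ws ! j) * ys ! j)"
proof -
  have *: "sum f (set ws) = (\<Sum>i<length ws. f (ws ! i))" for f :: "'a \<Rightarrow> real"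
    using sum.reindex_bij_betw[OF bij_betw_nth[OF V(3) refl refl], of f] by simp
  have **: "(\<Sum>v\<in>V. f v) = (\<Sum>v\<in>set ws. f v)" if "\<And>v. v \<notin> set ws \<Longrightarrow> f v = 0" for f :: "'a \<Rightarrow> real"
    using V that by (intro sum.mono_neutral_right) auto
  have "bform V b (supported ws xs) (supported ws ys) =
    (\<Sum>u\<in>set ws. \<Sum>v\<in>set ws. supported ws xs u * b u v * supported ws ys v)"
    unfolding bform_def by (simp add: ** supported_outside)
  also have "\<dots> = (\<Sum>i<length ws. \<Sum>j<length ws. xs ! i * b (ws ! i) (ws ! j) * ys ! j)"
    unfolding * by (intro sum.cong) (simp_all add: supported_nth V(3))
  finally show ?thesis .
qed

text \<open>This is the interlacing step: a positive plane of a principal 5 by 5 submatrix stays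
  positive after extension by zero. The five vertices are the fixed vertex \<open>v\<close> and
  those of a forbidden subgraph.\<close>

lemma two_positive_five:
  assumes V: "finite V" "{v, p, q, r, s} \<subseteq> V" "distinct [v, p, q, r, s]"
    and "\<exists>xs ys. (\<Sum>i<5. \<Sum>j<5. xs ! i * b ([v, p, q, r, s] ! i) ([v, p, q, r, s] ! j) * ys ! j) = 0 \<and>
      (\<Sum>i<5. \<Sum>j<5. xs ! i * b ([v, p, q, r, s] ! i) ([v, p, q, r, s] ! j) * xs ! j) > 0 \<and>
      (\<Sum>i<5. \<Sum>j<5. ys ! i * b ([v, p, q, r, s] ! i) ([v, p, q, r, s] ! j) * ys ! j) > 0"
  shows "two_positive V b"
proof -
  have ws: "set [v, p, q, r, s] \<subseteq> V" and len: "length [v, p, q, r, s] = 5" using V by auto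
  obtain xs ys where xy:
    "(\<Sum>i<5. \<Sum>j<5. xs ! i * b ([v, p, q, r, s] ! i) ([v, p, q, r, s] ! j) * ys ! j) = 0"
    "(\<Sum>i<5. \<Sum>j<5. xs ! i * b ([v, p, q, r, s] ! i) ([v, p, q, r, s] ! j) * xs ! j) > 0"
    "(\<Sum>i<5. \<Sum>j<5. ys ! i * b ([v, p, q, r, s] ! i) ([v, p, q, r, s] ! j) * ys ! j) > 0"
    using assms(4) by blast
  note bf = bform_supported[OF V(1) ws V(3), of b, unfolded len]
  show ?thesis
    unfolding two_positive_def
    by (intro exI[of _ "supported [v, p, q, r, s] xs"] exI[of _ "supported [v, p, q, r, s] ys"])
      (unfold bf, use xy in blast)
qed

text \<open>The hypotheses exclude, in this order, the induced subgraphs \<open>2K\<^sub>2\<close>, \<open>C\<^sub>4\<close>, \<open>P\<^sub>4\<close>,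
  \<open>P\<^sub>3 + K\<^sub>1\<close> and the paw.\<close>

lemma clique_or_coclique_structure:
  assumes sym: "\<And>u v. E u v \<Longrightarrow> E v u"
    and irr: "\<And>u. \<not> E u u"
    and b1: "\<And>p q r s. {p, q, r, s} \<subseteq> V \<Longrightarrow> distinct [p, q, r, s] \<Longrightarrow> E p q \<Longrightarrow> E r s \<Longrightarrow>
      \<not> E p r \<Longrightarrow> \<not> E p s \<Longrightarrow> \<not> E q r \<Longrightarrow> \<not> E q s \<Longrightarrow> False"
    and b2: "\<And>p q r s. {p, q, r, s} \<subseteq> V \<Longrightarrow> distinct [p, q, r, s] \<Longrightarrow> E p q \<Longrightarrow> E q r \<Longrightarrow> E r s \<Longrightarrow> E s p \<Longrightarrow>
      \<not> E p r \<Longrightarrow> \<not> E q s \<Longrightarrow> False"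
    and b3: "\<And>p q r s. {p, q, r, s} \<subseteq> V \<Longrightarrow> distinct [p, q, r, s] \<Longrightarrow> E p q \<Longrightarrow> E q r \<Longrightarrow> E r s \<Longrightarrow>
      \<not> E p r \<Longrightarrow> \<not> E p s \<Longrightarrow> \<not> E q s \<Longrightarrow> False"
    and b4: "\<And>p q r s. {p, q, r, s} \<subseteq> V \<Longrightarrow> distinct [p, q, r, s] \<Longrightarrow> E p q \<Longrightarrow> E q r \<Longrightarrow>
      \<not> E p r \<Longrightarrow> \<not> E p s \<Longrightarrow> \<not> E q s \<Longrightarrow> \<not> E r s \<Longrightarrow> False"
    and b5: "\<And>p q r s. {p, q, r, s} \<subseteq> V \<Longrightarrow> distinct [p, q, r, s] \<Longrightarrow> E p q \<Longrightarrow> E q r \<Longrightarrow> E r p \<Longrightarrow> E r s \<Longrightarrow>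
      \<not> E p s \<Longrightarrow> \<not> E q s \<Longrightarrow> False"
  shows "(\<exists>Q\<subseteq>V. \<forall>u\<in>V. \<forall>v\<in>V. u \<noteq> v \<longrightarrow> (E u v \<longleftrightarrow> u \<in> Q \<and> v \<in> Q)) \<or>
    (\<exists>C\<subseteq>V. \<forall>u\<in>V. \<forall>v\<in>V. u \<noteq> v \<longrightarrow> (E u v \<longleftrightarrow> \<not> (u \<in> C \<and> v \<in> C)))"
proof (cases "\<exists>p\<in>V. \<exists>q\<in>V. \<exists>r\<in>V. p \<noteq> r \<and> E p q \<and> E q r \<and> \<not> E p r")
  case False
  \<comment> \<open>Without an induced path on three vertices the components are cliques; excluding
    \<open>2K2\<close> leaves at most one component with an edge.\<close>
  then have tr: "E p r" if "p \<in> V" "q \<in> V" "r \<in> V" "p \<noteq> r" "E p q" "E q r" for p q r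
    using that by blast
  define Q where "Q = {u \<in> V. \<exists>w\<in>V. E u w}"
  have "E u v" if "u \<in> Q" "v \<in> Q" "u \<noteq> v" for u v
  proof (rule ccontr)
    assume n: "\<not> E u v"
    obtain w z where wz: "w \<in> V" "E u w" "z \<in> V" "E v z" "u \<in> V" "v \<in> V"
      using \<open>u \<in> Q\<close> \<open>v \<in> Q\<close> by (auto simp: Q_def)
    have nwv: "\<not> E w v" using tr[of u w v] wz n that by auto
    have nuz: "\<not> E u z" using tr[of u z v] wz n that sym by auto
    have "w \<noteq> z" using nwv wz sym by blast
    have nwz: "\<not> E w z" using tr[of u w z] wz nuz n sym by auto
    show False using b1[of u w v z] wz n nwv nuz nwz irr that sym by auto
  qed
  then have "\<forall>u\<in>V. \<forall>v\<in>V. u \<noteq> v \<longrightarrow> (E u v \<longleftrightarrow> u \<in> Q \<and> v \<in> Q)"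
    using sym unfolding Q_def by blast
  then show ?thesis by (intro disjI1 exI[of _ Q]) (auto simp: Q_def)
next
  case True
  then obtain p q r where pqr: "p \<in> V" "q \<in> V" "r \<in> V" "p \<noteq> r" "E p q" "E q r" "\<not> E p r" by blast
  have ne: "p \<noteq> q" "q \<noteq> r" using pqr irr by auto
  \<comment> \<open>Every other way to attach \<open>d\<close> to the induced path
    \<open>p, q, r\<close> produces \<open>P3 + K1\<close>, \<open>C4\<close>, \<open>P4\<close> or
    the paw.\<close>
  have d: "E d q \<and> (E d p \<longleftrightarrow> E d r)" if dV: "d \<in> V" "d \<noteq> p" "d \<noteq> q" "d \<noteq> r" for d
  proof -
    have s: "{p, q, r, d} \<subseteq> V" "distinct [p, q, r, d]" "{d, p, q, r} \<subseteq> V" "distinct [d, p, q, r]"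
      "{d, r, q, p} \<subseteq> V" "distinct [d, r, q, p]"
      using dV pqr ne by auto
    show ?thesis
      using b4[OF s(1,2)] b2[OF s(1,2)] b3[OF s(3,4)] b3[OF s(5,6)] b5[OF s(3,4)] b5[OF s(5,6)]
        pqr sym by blast
  qed
  \<comment> \<open>The coclique can be read off from \<open>p\<close>: it consists of the
    non-neighbours of \<open>p\<close>, and irreflexivity puts \<open>p\<close> itself into
    it.\<close>
  define C where "C = {x \<in> V. \<not> E x p}"
  have C: "E u v \<longleftrightarrow> \<not> (u \<in> C \<and> v \<in> C)" if uv: "u \<in> V" "v \<in> V" "u \<noteq> v" for u v
  proof (cases "{u, v} \<inter> {p, q, r} = {}")
    case False
    then show ?thesis using d[of u] d[of v] uv pqr irr sym unfolding C_def by (smt (verit) Int_emptyI insert_iff mem_Collect_eq singletonD)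
  next
    case True
    then have s: "{p, q, u, v} \<subseteq> V" "distinct [p, q, u, v]" "{p, q, v, u} \<subseteq> V" "distinct [p, q, v, u]"
      "{p, u, r, v} \<subseteq> V" "distinct [p, u, r, v]" "{u, v, q, p} \<subseteq> V" "distinct [u, v, q, p]"
      "{p, u, q, v} \<subseteq> V" "distinct [p, u, q, v]" "{p, v, q, u} \<subseteq> V" "distinct [p, v, q, u]"
      using uv pqr ne by auto
    have du: "E u q" "E u p \<longleftrightarrow> E u r" and dv: "E v q" "E v p \<longleftrightarrow> E v r"
      using d[of u] d[of v] True uv by auto
    \<comment> \<open>Unless both vertices are adjacent to \<open>p\<close>, a wrong adjacency gives
      a paw whose vertex of degree three is \<open>q\<close>. In the last case
      \<open>p, u, r, v\<close> would be an induced 4-cycle.\<close>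
    have "\<not> E u v" if "\<not> E u p" "\<not> E v p"
      using b5[OF s(7,8)] that du dv pqr sym by blast
    moreover have "E u v" if "\<not> E u p" "E v p"
      using b5[OF s(11,12)] that du dv pqr sym by blast
    moreover have "E u v" if "E u p" "\<not> E v p"
      using b5[OF s(9,10)] that du dv pqr sym by blast
    moreover have "E u v" if "E u p" "E v p"
      using b2[OF s(5,6)] that du dv pqr sym by blast
    ultimately show ?thesis using uv unfolding C_def by blast
  qed
  show ?thesis by (rule disjI2, rule exI[of _ C]) (use C in \<open>auto simp: C_def\<close>)
qed

section \<open>Reduction to a negative clique up to switching\<close>

text \<open>The structure lemma is applied to the graph \<open>E\<close> of negative edges away from
  \<open>v\<close>. A clique serves as \<open>S\<close> directly; the complementary outcome needs
  one more switching, which \<open>s\<close> records.\<close>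

lemma switching_form_normalized:
  fixes a :: "'v \<Rightarrow> 'v \<Rightarrow> real"
  assumes V: "finite V" and v: "v \<in> V"
    and sym: "\<And>x y. a x y = a y x" and diag: "\<And>x. a x x = 0"
    and vals: "\<And>x y. x \<in> V \<Longrightarrow> y \<in> V \<Longrightarrow> x \<noteq> y \<Longrightarrow> a x y = 1 \<or> a x y = -1"
    and pos: "\<And>x. x \<in> V \<Longrightarrow> x \<noteq> v \<Longrightarrow> a v x = 1"
    and np: "\<not> two_positive V (shift 1 a)" and nn: "\<not> two_positive V (shift (-1) a)"
  shows "\<exists>S\<subseteq>V. \<exists>s. (\<forall>u. s u = 1 \<or> s u = (-1 :: real)) \<and>
    (\<forall>x\<in>V. \<forall>y\<in>V. x \<noteq> y \<longrightarrow> a x y = s x * s y * (if x \<in> S \<and> y \<in> S then -1 else 1))"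
proof -
  define E where "E x y \<longleftrightarrow> a x y = -1" for x y
  define V' where "V' = V - {v}"
  have E: "a x y = (if E x y then -1 else 1)" if "x \<in> V" "y \<in> V" "x \<noteq> y" for x y
    using vals[OF that] by (auto simp: E_def)
  have bad: False
    if w: "{p, q, r, s} \<subseteq> V'" "distinct [p, q, r, s]" and c: "c = 1 \<or> c = -1"
      and ex: "\<exists>xs ys. (\<Sum>i<5. \<Sum>j<5. xs ! i * shift c a ([v, p, q, r, s] ! i) ([v, p, q, r, s] ! j) * ys ! j) = 0 \<and>
      (\<Sum>i<5. \<Sum>j<5. xs ! i * shift c a ([v, p, q, r, s] ! i) ([v, p, q, r, s] ! j) * xs ! j) > 0 \<and>
      (\<Sum>i<5. \<Sum>j<5. ys ! i * shift c a ([v, p, q, r, s] ! i) ([v, p, q, r, s] ! j) * ys ! j) > 0" for p q r s c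
  proof -
    have "two_positive V (shift c a)"
      by (rule two_positive_five[OF V _ _ ex]) (use w v in \<open>auto simp: V'_def\<close>)
    then show False using np nn c by auto
  qed
  \<comment> \<open>Listing both orientations of every pair makes each witness check below pure
    arithmetic after rewriting.\<close>
  have ent: "a p v = 1" "a q v = 1" "a r v = 1" "a s v = 1" "a v p = 1" "a v q = 1" "a v r = 1" "a v s = 1"
    "a p q = (if E p q then -1 else 1)" "a p r = (if E p r then -1 else 1)" "a p s = (if E p s then -1 else 1)"
    "a q r = (if E q r then -1 else 1)" "a q s = (if E q s then -1 else 1)" "a r s = (if E r s then -1 else 1)"
    "a q p = (if E p q then -1 else 1)" "a r p = (if E p r then -1 else 1)" "a s p = (if E p s then -1 else 1)"
    "a r q = (if E q r then -1 else 1)" "a s q = (if E q s then -1 else 1)" "a s r = (if E r s then -1 else 1)"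
    "p \<noteq> v" "q \<noteq> v" "r \<noteq> v" "s \<noteq> v" "v \<noteq> p" "v \<noteq> q" "v \<noteq> r" "v \<noteq> s"
    "q \<noteq> p" "r \<noteq> p" "s \<noteq> p" "r \<noteq> q" "s \<noteq> q" "s \<noteq> r"
    if "{p, q, r, s} \<subseteq> V'" "distinct [p, q, r, s]" for p q r s
    using that sym pos E unfolding V'_def E_def by (auto 0 2)
  \<comment> \<open>Each forbidden subgraph together with \<open>v\<close> carries a plane on which \<open>c * a - 1\<close> is positive
    definite; the witnesses below are bases of such planes, found by search.\<close>
  note num = numeral_eq_Suc lessThan_Suc shift_def diag
  have "(\<exists>Q\<subseteq>V'. \<forall>u\<in>V'. \<forall>v\<in>V'. u \<noteq> v \<longrightarrow> (E u v \<longleftrightarrow> u \<in> Q \<and> v \<in> Q)) \<or>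
    (\<exists>C\<subseteq>V'. \<forall>u\<in>V'. \<forall>v\<in>V'. u \<noteq> v \<longrightarrow> (E u v \<longleftrightarrow> \<not> (u \<in> C \<and> v \<in> C)))"
  proof (rule clique_or_coclique_structure)
    show "E x y \<Longrightarrow> E y x" for x y using sym by (simp add: E_def)
    show "\<not> E x x" for x by (simp add: E_def diag)
  next
    fix p q r s assume w: "{p, q, r, s} \<subseteq> V'" "distinct [p, q, r, s]"
      and e: "E p q" "E r s" "\<not> E p r" "\<not> E p s" "\<not> E q r" "\<not> E q s"
    show False
      by (rule bad[OF w, of "-1"], simp, rule exI[of _ "[-2,0,0,1,1]"], rule exI[of _ "[-1,1,1,0,0]"])
        (use w(2) e in \<open>simp add: num ent[OF w]\<close>)
  next
    fix p q r s assume w: "{p, q, r, s} \<subseteq> V'" "distinct [p, q, r, s]"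
      and e: "E p q" "E q r" "E r s" "E s p" "\<not> E p r" "\<not> E q s"
    then have e': "E p s" using sym by (simp add: E_def)
    show False
      by (rule bad[OF w, of 1], simp, rule exI[of _ "[-2,-1,0,-1,0]"], rule exI[of _ "[-1,0,-1,0,-1]"])
        (use w(2) e e' in \<open>simp add: num ent[OF w]\<close>)
  next
    fix p q r s assume w: "{p, q, r, s} \<subseteq> V'" "distinct [p, q, r, s]"
      and e: "E p q" "E q r" "E r s" "\<not> E p r" "\<not> E p s" "\<not> E q s"
    show False
      by (rule bad[OF w, of 1], simp, rule exI[of _ "[-1,-1,-1,0,-1]"], rule exI[of _ "[0,-1,1,-1,0]"])
        (use w(2) e in \<open>simp add: num ent[OF w]\<close>)
  next
    fix p q r s assume w: "{p, q, r, s} \<subseteq> V'" "distinct [p, q, r, s]"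
      and e: "E p q" "E q r" "\<not> E p r" "\<not> E p s" "\<not> E q s" "\<not> E r s"
    show False
      by (rule bad[OF w, of 1], simp, rule exI[of _ "[-1,0,-2,0,-1]"], rule exI[of _ "[0,-1,1,-1,0]"])
        (use w(2) e in \<open>simp add: num ent[OF w]\<close>)
  next
    fix p q r s assume w: "{p, q, r, s} \<subseteq> V'" "distinct [p, q, r, s]"
      and e: "E p q" "E q r" "E r p" "E r s" "\<not> E p s" "\<not> E q s"
    then have e': "E p r" using sym by (simp add: E_def)
    show False
      by (rule bad[OF w, of "-1"], simp, rule exI[of _ "[-1,0,0,1,1]"], rule exI[of _ "[0,-1,-1,0,2]"])
        (use w(2) e e' in \<open>simp add: num ent[OF w]\<close>)
  qed
  then show ?thesis
  proof (elim disjE exE conjE)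
    fix Q assume Q: "Q \<subseteq> V'" "\<forall>u\<in>V'. \<forall>v\<in>V'. u \<noteq> v \<longrightarrow> (E u v \<longleftrightarrow> u \<in> Q \<and> v \<in> Q)"
    have "a x y = (if x \<in> Q \<and> y \<in> Q then -1 else 1)" if "x \<in> V" "y \<in> V" "x \<noteq> y" for x y
    proof (cases "x = v \<or> y = v")
      case True
      then show ?thesis using that Q(1) pos[of x] pos[of y] sym[of x v] unfolding V'_def by auto
    next
      case False
      then show ?thesis using that Q(2) by (simp add: E V'_def)
    qed
    then show ?thesis using Q by (intro exI[of _ Q] conjI exI[of _ "\<lambda>_. 1"]) (auto simp: V'_def)
  next
    fix C assume C: "C \<subseteq> V'" "\<forall>u\<in>V'. \<forall>v\<in>V'. u \<noteq> v \<longrightarrow> (E u v \<longleftrightarrow> \<not> (u \<in> C \<and> v \<in> C))"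
    \<comment> \<open>Switching the vertices outside \<open>C\<close> other than \<open>v\<close>
      makes their edges to \<open>C\<close> positive and their edges to \<open>v\<close> negative,
      while the edges among them stay negative. The negative edges then form the clique on
      \<open>V - C\<close>, which contains \<open>v\<close>.\<close>
    define s where "s x = (if x = v \<or> x \<in> C then 1 else (-1 :: real))" for x
    have "a x y = s x * s y * (if x \<in> V - C \<and> y \<in> V - C then -1 else 1)" if "x \<in> V" "y \<in> V" "x \<noteq> y" for x y
    proof (cases "x = v \<or> y = v")
      case True
      then show ?thesis using that C(1) pos[of x] pos[of y] sym[of x v] unfolding V'_def s_def by auto
    next
      case False
      then show ?thesis using that C(2) by (simp add: E V'_def s_def)
    qed
    moreover have "\<forall>x. s x = 1 \<or> s x = -1" by (auto simp: s_def)
    ultimately show ?thesis by (intro exI[of _ "V - C"] conjI exI[of _ s]) auto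
  qed
qed

text \<open>The function \<open>s\<close> is the diagonal of a switching matrix. It takes the values
  1 and -1 everywhere, also outside \<open>V\<close>, so that switchings compose by pointwise
  multiplication.\<close>

definition negative_clique_form :: "'v set \<Rightarrow> ('v \<Rightarrow> 'v \<Rightarrow> real) \<Rightarrow> 'v set \<Rightarrow> ('v \<Rightarrow> real) \<Rightarrow> bool" where
  "negative_clique_form V a S s \<longleftrightarrow> S \<subseteq> V \<and> (\<forall>u. s u = 1 \<or> s u = -1) \<and>
    (\<forall>u\<in>V. \<forall>v\<in>V. u \<noteq> v \<longrightarrow> a u v = s u * s v * (if u \<in> S \<and> v \<in> S then -1 else 1))"

lemma negative_clique_form_unswitch:
  assumes t: "\<And>u. t u = 1 \<or> t u = (-1 :: real)"
    and "negative_clique_form V (\<lambda>u v. t u * t v * a u v) S s"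
  shows "negative_clique_form V a S (\<lambda>u. t u * s u)"
proof -
  have tt: "t u * t u = 1" for u using t[of u] by auto
  have "a u v = t u * s u * (t v * s v) * (if u \<in> S \<and> v \<in> S then - 1 else 1)"
    if "u \<in> V" "v \<in> V" "u \<noteq> v" for u v
  proof -
    have "t u * t v * a u v = s u * s v * (if u \<in> S \<and> v \<in> S then -1 else 1)"
      using assms(2) that unfolding negative_clique_form_def by blast
    then have "(t u * t u) * (t v * t v) * a u v = t u * t v * (s u * s v * (if u \<in> S \<and> v \<in> S then -1 else 1))"
      by (metis mult.assoc mult.left_commute)
    then show ?thesis by (simp add: tt mult_ac)
  qed
  moreover have "t u * s u = 1 \<or> t u * s u = -1" for u
    using t[of u] assms(2) unfolding negative_clique_form_def by (metis minus_mult_minus mult_1 mult_minus1)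
  ultimately show ?thesis using assms(2) unfolding negative_clique_form_def by blast
qed

text \<open>Switching is conjugation by a diagonal matrix of signs, hence a change of variables in
  the form; the identity part of \<open>shift\<close> is unaffected because signs square to 1.
  Spectral hypotheses therefore survive switching.\<close>

lemma bform_switch:
  fixes t :: "'v \<Rightarrow> real"
  assumes "\<And>u. t u = 1 \<or> t u = -1"
  shows "bform V (shift c (\<lambda>u v. t u * t v * a u v)) x y =
    bform V (shift c a) (\<lambda>u. t u * x u) (\<lambda>u. t u * y u)"
proof -
  have tt: "t u * t u = 1" for u using assms[of u] by auto
  have "x u * shift c (\<lambda>u v. t u * t v * a u v) u v * y v = t u * x u * shift c a u v * (t v * y v)" for u v
    using tt[of v] by (cases "u = v") (auto simp: shift_def algebra_simps)
  then show ?thesis unfolding bform_def by (intro sum.cong refl)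
qed

lemma negative_clique_form_exists:
  fixes a :: "'v \<Rightarrow> 'v \<Rightarrow> real"
  assumes V: "finite V"
    and sym: "\<And>x y. a x y = a y x" and diag: "\<And>x. a x x = 0"
    and vals: "\<And>x y. x \<in> V \<Longrightarrow> y \<in> V \<Longrightarrow> x \<noteq> y \<Longrightarrow> a x y = 1 \<or> a x y = -1"
    and spec: "(\<not> two_positive V (shift 1 a) \<and> \<not> two_positive V (shift (-1) a)) \<or>
      (\<forall>x. bform V (shift 1 a) x x \<le> 0) \<or> (\<forall>x. bform V (shift (-1) a) x x \<le> 0)"
  shows "\<exists>S s. negative_clique_form V a S s"
proof (cases "V = {}")
  case True
  then show ?thesis by (intro exI[of _ "{}"] exI[of _ "\<lambda>_. 1"]) (auto simp: negative_clique_form_def)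
next
  case False
  then obtain v where v: "v \<in> V" by blast
  \<comment> \<open>Multiplying row and column \<open>u\<close> by \<open>a v u\<close> squares the
    entry at \<open>v, u\<close>, so all edges at \<open>v\<close> become positive.\<close>
  define t where "t u = (if u \<in> V \<and> u \<noteq> v then a v u else 1)" for u
  have t: "t u = 1 \<or> t u = -1" for u using vals[OF v, of u] by (auto simp: t_def)
  define b where "b = (\<lambda>u w. t u * t w * a u w)"
  have tt: "t u * t u = 1" for u using t[of u] by auto
  have bsym: "b x y = b y x" for x y using sym[of x y] by (simp add: b_def)
  have bdiag: "b x x = 0" for x using diag by (simp add: b_def)
  have bvals: "b x y = 1 \<or> b x y = -1" if "x \<in> V" "y \<in> V" "x \<noteq> y" for x y
    using vals[OF that] t[of x] t[of y] by (auto simp: b_def)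
  have bpos: "b v x = 1" if "x \<in> V" "x \<noteq> v" for x
    using that vals[OF v that(1)] by (auto simp: b_def t_def)
  have sw: "bform V (shift c b) x y = bform V (shift c a) (\<lambda>u. t u * x u) (\<lambda>u. t u * y u)" for c x y
    unfolding b_def by (rule bform_switch[OF t])
  have "\<exists>S s. negative_clique_form V b S s"
    using spec
  proof (elim disjE conjE)
    assume "\<not> two_positive V (shift 1 a)" "\<not> two_positive V (shift (-1) a)"
    then have "\<not> two_positive V (shift 1 b)" "\<not> two_positive V (shift (-1) b)"
      unfolding two_positive_def sw by blast+
    from switching_form_normalized[OF V v bsym bdiag bvals bpos this]
    show ?thesis unfolding negative_clique_form_def by blast
  next
    assume "\<forall>x. bform V (shift 1 a) x x \<le> 0"
    then have le: "bform V (shift 1 b) x x \<le> 0" for x using sw by simp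
    have "b x y = -1" if xy: "x \<in> V" "y \<in> V" "x \<noteq> y" "x \<noteq> v" "y \<noteq> v" for x y
    proof (rule ccontr)
      assume "b x y \<noteq> -1"
      then have "b x y = 1" using bvals xy by blast
      moreover have "distinct [v, x, y]" "set [v, x, y] \<subseteq> V" using xy v by auto
      \<comment> \<open>A positive triangle has eigenvalue 2 with the all-ones eigenvector, which
        gives the value (2 - 1) * 3.\<close>
      ultimately have "bform V (shift 1 b) (supported [v, x, y] [1, 1, 1]) (supported [v, x, y] [1, 1, 1]) = 3"
        using xy bpos[of x] bpos[of y] bsym[of x v] bsym[of y v] bsym[of y x]
        by (subst bform_supported[OF V]) (auto simp: lessThan_Suc numeral_eq_Suc shift_def bdiag)
      then show False using le[of "supported [v, x, y] [1, 1, 1]"] by simp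
    qed
    moreover have "b x v = 1" if "x \<in> V" "x \<noteq> v" for x using bpos[OF that] bsym[of x v] by simp
    ultimately have "negative_clique_form V b (V - {v}) (\<lambda>_. 1)"
      using bpos unfolding negative_clique_form_def by auto
    then show ?thesis by blast
  next
    assume "\<forall>x. bform V (shift (-1) a) x x \<le> 0"
    then have le: "bform V (shift (-1) b) x x \<le> 0" for x using sw by simp
    have "b x y = 1" if xy: "x \<in> V" "y \<in> V" "x \<noteq> y" "x \<noteq> v" "y \<noteq> v" for x y
    proof (rule ccontr)
      assume "b x y \<noteq> 1"
      then have "b x y = -1" using bvals xy by blast
      moreover have "distinct [v, x, y]" "set [v, x, y] \<subseteq> V" using xy v by auto
      \<comment> \<open>A triangle whose only negative edge is \<open>x, y\<close> has eigenvalue -2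
        with eigenvector \<open>[1, -1, -1]\<close>, which again gives the value 3.\<close>
      ultimately have "bform V (shift (-1) b) (supported [v, x, y] [1, -1, -1]) (supported [v, x, y] [1, -1, -1]) = 3"
        using xy bpos[of x] bpos[of y] bsym[of x v] bsym[of y v] bsym[of y x]
        by (subst bform_supported[OF V]) (auto simp: lessThan_Suc numeral_eq_Suc shift_def bdiag)
      then show False using le[of "supported [v, x, y] [1, -1, -1]"] by simp
    qed
    moreover have "b x v = 1" if "x \<in> V" "x \<noteq> v" for x using bpos[OF that] bsym[of x v] by simp
    ultimately have "negative_clique_form V b {} (\<lambda>_. 1)"
      using bpos unfolding negative_clique_form_def by auto
    then show ?thesis by blast
  qed
  then show ?thesis using negative_clique_form_unswitch[where t = t and V = V and a = a, OF t]
    unfolding b_def by blast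
qed

text \<open>The set \<open>S\<close> is not unique. A clique on one vertex has no edges, so the
  empty set may be replaced by a singleton; switching one vertex of an all-negative graph replaces
  \<open>V\<close> by \<open>V - {v}\<close>. Removing both extremes matters because the cubic trace
  takes the same value for sizes 0 and 1. With fewer than two vertices there are no edges and the
  empty set is the chosen representative.\<close>

lemma negative_clique_form_proper:
  assumes "negative_clique_form V a S s" and V: "finite V"
  shows "\<exists>S s. negative_clique_form V a S s \<and> (if card V < 2 then S = {} else S \<noteq> {} \<and> S \<noteq> V)"
proof (cases "card V < 2")
  case True
  then have "u = v" if "u \<in> V" "v \<in> V" for u v
    using V that card_le_Suc0_iff_eq[OF V] by simp
  then have "negative_clique_form V a {} s" using assms(1) unfolding negative_clique_form_def by blast
  then show ?thesis using True by auto
next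
  case False
  then obtain v w where vw: "v \<in> V" "w \<in> V" "v \<noteq> w"
    using V card_le_Suc0_iff_eq[OF V] by force
  note nf = assms(1)[unfolded negative_clique_form_def]
  consider "S = {}" | "S = V" | "S \<noteq> {}" "S \<noteq> V" by blast
  then show ?thesis
  proof cases
    case 1
    then have "negative_clique_form V a {v} s" using nf vw unfolding negative_clique_form_def by auto
    then show ?thesis using False vw by auto
  next
    case 2
    have "negative_clique_form V a (V - {v}) (\<lambda>u. if u = v then - s u else s u)"
      using nf vw 2 unfolding negative_clique_form_def by auto
    moreover have "V - {v} \<noteq> {}" "V - {v} \<noteq> V" using vw by auto
    ultimately show ?thesis using False by auto
  next
    case 3
    then show ?thesis using False assms by auto
  qed
qed

section \<open>The trace of the cube as a function of the clique size\<close>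

text \<open>With \<open>x = n - 2 * q\<close> the expression equals half of x * (3 n^2 - 6 n + 4 -
  x^2). The difference at \<open>x\<close> and \<open>y\<close> has the factors x - y and 3 n^2 - 6
  n + 4 - (x^2 + x y + y^2), and the second is positive because both absolute values are at most n -
  2.\<close>

lemma cubic_trace_strict:
  fixes n :: real
  assumes "n \<ge> 2" "1 \<le> q" "q < r" "r \<le> n - 1"
  shows "(n - 2 * r) * (2 * r * (n - r) + (n - 1) * (n - 2)) < (n - 2 * q) * (2 * q * (n - q) + (n - 1) * (n - 2))"
proof -
  define x y where "x = n - 2 * q" and "y = n - 2 * r"
  have xy: "\<bar>x\<bar> \<le> n - 2" "\<bar>y\<bar> \<le> n - 2" "y < x" using assms by (auto simp: x_def y_def)
  have "x\<^sup>2 \<le> (n - 2)\<^sup>2" "y\<^sup>2 \<le> (n - 2)\<^sup>2" using xy by (metis abs_le_square_iff abs_of_nonneg abs_ge_zero order_trans)+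
  moreover have "x * y \<le> (n - 2)\<^sup>2"
    using calculation sum_squares_bound[of x y] by linarith
  ultimately have "x\<^sup>2 + x * y + y\<^sup>2 \<le> 3 * (n - 2)\<^sup>2" by linarith
  also have "\<dots> < 3 * n\<^sup>2 - 6 * n + 4" using assms by (simp add: power2_eq_square algebra_simps)
  finally have "0 < (x - y) * (3 * n\<^sup>2 - 6 * n + 4 - (x\<^sup>2 + x * y + y\<^sup>2))" using xy by simp
  also have "\<dots> = 2 * ((n - 2 * q) * (2 * q * (n - q) + (n - 1) * (n - 2)) -
      (n - 2 * r) * (2 * r * (n - r) + (n - 1) * (n - 2)))"
    unfolding x_def y_def by (simp add: power2_eq_square algebra_simps)
  finally show ?thesis by simp
qed

lemma cubic_trace_negative_clique_form:
  fixes a :: "'v \<Rightarrow> 'v \<Rightarrow> real"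
  assumes V: "finite V" and nf: "negative_clique_form V a S s" and diag: "\<And>x. a x x = 0"
  defines "n \<equiv> real (card V)" and "q \<equiv> real (card S)"
  shows "(\<Sum>u\<in>V. \<Sum>w\<in>V. \<Sum>v\<in>V. a u v * a v w * a w u) = (n - 2 * q) * (2 * q * (n - q) + (n - 1) * (n - 2))"
proof -
  define e where "e u = (if u \<in> S then -1 else (1 :: real))" for u
  have S: "S \<subseteq> V" using nf by (simp add: negative_clique_form_def)
  have fS: "finite S" using S V finite_subset by blast
  have s: "s u * s u = 1" for u using nf unfolding negative_clique_form_def by (metis minus_mult_minus mult_1)
  have sumV: "sum f V = sum f S + sum f (V - S)" for f :: "'v \<Rightarrow> real"
    using sum.subset_diff[OF S V, of f] by simp
  have cT: "real (card (V - S)) = n - q"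
    unfolding n_def q_def using card_Diff_subset[OF fS S] card_mono[OF V S] by (simp add: of_nat_diff)
  have se: "sum e V = n - 2 * q"
    unfolding sumV e_def using cT by (simp add: q_def)
  have a: "a u v = s u * s v * (if u \<in> S \<and> v \<in> S then -1 else 1)" if "u \<in> V" "v \<in> V" "u \<noteq> v" for u v
    using nf that unfolding negative_clique_form_def by blast
  have inner: "(\<Sum>v\<in>V. a u v * a v w * a w u) = (if u \<in> S \<longleftrightarrow> w \<in> S then (n - 2) * e u else n - 2 * q)"
    if uw: "u \<in> V" "w \<in> V" "u \<noteq> w" for u w
  proof -
    have "(\<Sum>v\<in>V. a u v * a v w * a w u) = (\<Sum>v\<in>V - {u, w}. a u v * a v w * a w u)"
      using V diag by (intro sum.mono_neutral_right) auto
    \<comment> \<open>Switching signs occur twice around a triangle and cancel. What remains is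
      negative exactly when at least two vertices lie in \<open>S\<close>: if \<open>u\<close> and
      \<open>w\<close> lie on the same side, that side decides, otherwise \<open>v\<close>
      decides.\<close>
    also have "\<dots> = (\<Sum>v\<in>V - {u, w}. if u \<in> S \<longleftrightarrow> w \<in> S then e u else e v)"
    proof (rule sum.cong)
      fix v assume v: "v \<in> V - {u, w}"
      have auv: "a u v = s u * s v * (if u \<in> S \<and> v \<in> S then -1 else 1)"
        and avw: "a v w = s v * s w * (if v \<in> S \<and> w \<in> S then -1 else 1)"
        and awu: "a w u = s w * s u * (if w \<in> S \<and> u \<in> S then -1 else 1)"
        using v uw by (intro a; auto)+
      have "a u v * a v w * a w u = (s u * s u) * (s v * s v) * (s w * s w) *
        ((if u \<in> S \<and> v \<in> S then -1 else 1) * (if v \<in> S \<and> w \<in> S then -1 else 1) * (if w \<in> S \<and> u \<in> S then -1 else 1))"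
        unfolding auv avw awu by (simp only: mult_ac)
      then show "a u v * a v w * a w u = (if u \<in> S \<longleftrightarrow> w \<in> S then e u else e v)"
        by (simp add: s e_def)
    qed simp
    \<comment> \<open>For \<open>u\<close> and \<open>w\<close> on opposite sides the subtracted
      terms \<open>e u\<close> and \<open>e w\<close> cancel.\<close>
    also have "\<dots> = (\<Sum>v\<in>V. if u \<in> S \<longleftrightarrow> w \<in> S then e u else e v) - (\<Sum>v\<in>{u, w}. if u \<in> S \<longleftrightarrow> w \<in> S then e u else e v)"
      using V uw by (subst sum_diff) auto
    also have "\<dots> = (if u \<in> S \<longleftrightarrow> w \<in> S then (n - 2) * e u else n - 2 * q)"
      using uw se by (auto simp: n_def e_def algebra_simps)
    finally show ?thesis .
  qed
  have outer: "(\<Sum>w\<in>V. \<Sum>v\<in>V. a u v * a v w * a w u) =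
      (if u \<in> S then - (q - 1) * (n - 2) + (n - q) * (n - 2 * q) else (n - q - 1) * (n - 2) + q * (n - 2 * q))"
    if u: "u \<in> V" for u
  proof -
    have "(\<Sum>w\<in>V. \<Sum>v\<in>V. a u v * a v w * a w u) = (\<Sum>w\<in>V - {u}. \<Sum>v\<in>V. a u v * a v w * a w u)"
      using V diag by (intro sum.mono_neutral_right) auto
    also have "\<dots> = (\<Sum>w\<in>V - {u}. if u \<in> S \<longleftrightarrow> w \<in> S then (n - 2) * e u else n - 2 * q)"
      using u by (intro sum.cong) (auto simp: inner)
    also have "\<dots> = (\<Sum>w\<in>V. if u \<in> S \<longleftrightarrow> w \<in> S then (n - 2) * e u else n - 2 * q) - (n - 2) * e u"
      using V u by (simp add: sum_diff1)
    also have "(\<Sum>w\<in>V. if u \<in> S \<longleftrightarrow> w \<in> S then (n - 2) * e u else n - 2 * q) =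
       (\<Sum>w\<in>S. if u \<in> S then (n - 2) * e u else n - 2 * q) + (\<Sum>w\<in>V - S. if u \<in> S then n - 2 * q else (n - 2) * e u)"
      unfolding sumV by (intro arg_cong2[of _ _ _ _ "(+)"] sum.cong) auto
    also have "\<dots> = q * (if u \<in> S then (n - 2) * e u else n - 2 * q) + (n - q) * (if u \<in> S then n - 2 * q else (n - 2) * e u)"
      by (simp add: cT q_def)
    also have "\<dots> - (n - 2) * e u = (if u \<in> S then - (q - 1) * (n - 2) + (n - q) * (n - 2 * q)
        else (n - q - 1) * (n - 2) + q * (n - 2 * q))"
      by (simp add: e_def algebra_simps)
    finally show ?thesis .
  qed
  have "(\<Sum>u\<in>V. \<Sum>w\<in>V. \<Sum>v\<in>V. a u v * a v w * a w u) =
    (\<Sum>u\<in>V. if u \<in> S then - (q - 1) * (n - 2) + (n - q) * (n - 2 * q) else (n - q - 1) * (n - 2) + q * (n - 2 * q))"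
    by (intro sum.cong) (auto simp: outer)
  also have "\<dots> = q * (- (q - 1) * (n - 2) + (n - q) * (n - 2 * q)) + (n - q) * ((n - q - 1) * (n - 2) + q * (n - 2 * q))"
    unfolding sumV by (simp add: cT q_def)
  also have "\<dots> = (n - 2 * q) * (2 * q * (n - q) + (n - 1) * (n - 2))"
    by (simp add: algebra_simps)
  finally show ?thesis .
qed

section \<open>Quadratic forms and traces in terms of the spectrum\<close>

lemma proots_linear_factors: "proots (\<Prod>e\<leftarrow>es. [:- e, 1:]) = mset (es :: complex list)"
proof (induction es)
  case (Cons e es)
  have "(\<Prod>e\<leftarrow>es. [:- e, 1:]) \<noteq> 0" by (auto simp: prod_list_zero_iff)
  then show ?case using Cons proots_mult[of "[:- e, 1:]"] by (simp del: mult_pCons_left)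
qed simp

text \<open>The unitary diagonalization is restated entrywise, with real eigenvalues. Orthonormality
  of the rows expands the identity matrix, as needed for \<open>shift\<close>; orthonormality of the
  columns gives products and traces.\<close>

lemma symmetric_spectral_decomposition:
  fixes a :: "nat \<Rightarrow> nat \<Rightarrow> real" and n :: nat
  assumes sym: "\<And>j k. a j k = a k j"
  defines "A \<equiv> mat n n (\<lambda>(j, k). complex_of_real (a j k))"
  shows "\<exists>(es :: real list) (U :: nat \<Rightarrow> nat \<Rightarrow> complex). length es = n \<and>
    mset (map complex_of_real es) = proots (char_poly A) \<and>
    (\<forall>j<n. \<forall>k<n. complex_of_real (a j k) = (\<Sum>i<n. of_real (es ! i) * U j i * cnj (U k i))) \<and>
    (\<forall>j<n. \<forall>k<n. (\<Sum>i<n. U j i * cnj (U k i)) = (if j = k then 1 else 0)) \<and>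
    (\<forall>i<n. \<forall>l<n. (\<Sum>j<n. cnj (U j i) * U j l) = (if i = l then 1 else 0))"
proof -
  have A: "A \<in> carrier_mat n n" by (simp add: A_def)
  have AH: "mat_adjoint A = A"
    by (rule eq_matI) (auto simp: A_def sym)
  obtain cs where cs: "char_poly A = (\<Prod>e\<leftarrow>cs. [:- e, 1:])" "length cs = n"
    using char_poly_factorized[OF A] by blast
  obtain W where W: "W \<in> carrier_mat n n" and WW: "mat_adjoint W * W = 1\<^sub>m n"
    and AW: "A = W * mat_diag n (\<lambda>i. cs ! i) * mat_adjoint W"
    using hermitian_unitary_diagonalization[OF A AH cs(1)] by blast
  note W' = mat_adjoint_carrier[OF W]
  have WW': "W * mat_adjoint W = 1\<^sub>m n"
    using mat_mult_left_right_inverse[OF W' W WW] .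
  define D where "D = mat_diag n (\<lambda>i. cs ! i)"
  have D: "D \<in> carrier_mat n n" by (simp add: D_def)
  note assoc = assoc_mult_mat[of _ n n _ n _ n] mult_carrier_mat[of _ n n _ n]
  have "D = 1\<^sub>m n * D * 1\<^sub>m n" using D by simp
  also have "\<dots> = mat_adjoint W * A * W"
    unfolding WW[symmetric] AW D_def[symmetric] using W W' D by (simp add: assoc)
  finally have DA: "D = mat_adjoint W * A * W" .
  \<comment> \<open>A diagonal matrix that equals its adjoint has real entries.\<close>
  have "mat_adjoint D = D"
    unfolding DA using W W' A by (simp add: mat_adjoint_mult[of _ n n _ n] assoc AH)
  then have DD: "mat_adjoint D $$ (i, i) = D $$ (i, i)" for i by simp
  have "cnj (cs ! i) = cs ! i" if "i < n" for i
    using DD[of i] that by (simp add: D_def mat_diag_def)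
  then have cr: "complex_of_real (Re (cs ! i)) = cs ! i" if "i < n" for i
    using that by (simp add: complex_eq_iff)
  define U where "U j i = W $$ (j, i)" for j i
  have "map complex_of_real (map Re cs) = cs"
    using cr cs(2) by (intro nth_equalityI) auto
  moreover have "proots (char_poly A) = mset cs"
    unfolding cs(1) by (rule proots_linear_factors)
  moreover have "complex_of_real (a j k) = (\<Sum>i<n. of_real (map Re cs ! i) * U j i * cnj (U k i))"
    if "j < n" "k < n" for j k
  proof -
    have "complex_of_real (a j k) = A $$ (j, k)" using that by (simp add: A_def)
    also have "\<dots> = (\<Sum>i<n. of_real (map Re cs ! i) * U j i * cnj (U k i))"
      using that W cs(2) unfolding AW
      by (simp add: mat_diag_mult_right[of _ n n] scalar_prod_def U_def cr mult_ac atLeast0LessThan)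
    finally show ?thesis .
  qed
  moreover have "(\<Sum>i<n. U j i * cnj (U k i)) = (if j = k then 1 else 0)" if "j < n" "k < n" for j k
    using that W arg_cong[OF WW', of "\<lambda>M. M $$ (j, k)"]
    by (simp add: scalar_prod_def U_def atLeast0LessThan)
  moreover have "(\<Sum>j<n. cnj (U j i) * U j l) = (if i = l then 1 else 0)" if "i < n" "l < n" for i l
    using that W arg_cong[OF WW, of "\<lambda>M. M $$ (i, l)"]
    by (simp add: scalar_prod_def U_def atLeast0LessThan)
  ultimately show ?thesis using cs(2) by (intro exI[of _ "map Re cs"] exI[of _ U] conjI allI impI) simp_all
qed

text \<open>In eigenvector coordinates the form is a weighted sum of squared moduli. The vector
  \<open>z\<close> is complex because \<open>not_two_positive\<close> combines real vectors with
  complex coefficients.\<close>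

lemma hermitian_form_expansion:
  fixes n :: nat and U :: "nat \<Rightarrow> nat \<Rightarrow> complex"
  assumes "\<And>j k. j < n \<Longrightarrow> k < n \<Longrightarrow> complex_of_real (b j k) = (\<Sum>i<n. of_real (m i) * U j i * cnj (U k i))"
  shows "(\<Sum>j<n. \<Sum>k<n. z j * of_real (b j k) * cnj (z k)) =
    of_real (\<Sum>i<n. m i * (cmod (\<Sum>j<n. z j * U j i))\<^sup>2)"
proof -
  have "(\<Sum>j<n. \<Sum>k<n. z j * of_real (b j k) * cnj (z k)) =
      (\<Sum>j<n. \<Sum>k<n. \<Sum>i<n. of_real (m i) * ((z j * U j i) * cnj (z k * U k i)))"
    by (intro sum.cong) (auto simp: assms sum_distrib_left sum_distrib_right mult_ac)
  also have "\<dots> = (\<Sum>j<n. \<Sum>i<n. \<Sum>k<n. of_real (m i) * ((z j * U j i) * cnj (z k * U k i)))"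
    by (rule sum.cong[OF refl], rule sum.swap)
  also have "\<dots> = (\<Sum>i<n. \<Sum>j<n. \<Sum>k<n. of_real (m i) * ((z j * U j i) * cnj (z k * U k i)))"
    by (rule sum.swap)
  also have "\<dots> = (\<Sum>i<n. of_real (m i) * ((\<Sum>j<n. z j * U j i) * cnj (\<Sum>k<n. z k * U k i)))"
    by (simp only: cnj_sum sum_product) (simp only: sum_distrib_left)
  finally show ?thesis by (simp only: of_real_sum of_real_mult complex_norm_square)
qed

lemma bform_nonpos:
  fixes n :: nat and U :: "nat \<Rightarrow> nat \<Rightarrow> complex"
  assumes b: "\<And>j k. j < n \<Longrightarrow> k < n \<Longrightarrow> complex_of_real (b j k) = (\<Sum>i<n. of_real (m i) * U j i * cnj (U k i))"
    and m: "\<And>i. i < n \<Longrightarrow> m i \<le> 0"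
  shows "bform {..<n} b x x \<le> 0"
proof -
  have "complex_of_real (bform {..<n} b x x) = of_real (\<Sum>i<n. m i * (cmod (\<Sum>j<n. of_real (x j) * U j i))\<^sup>2)"
    using hermitian_form_expansion[OF b, where z = "\<lambda>j. of_real (x j)"] by (simp add: bform_def)
  then have "bform {..<n} b x x = (\<Sum>i<n. m i * (cmod (\<Sum>j<n. of_real (x j) * U j i))\<^sup>2)"
    by (simp only: of_real_eq_iff)
  also have "\<dots> \<le> 0" using m by (intro sum_nonpos) (auto intro: mult_nonpos_nonneg)
  finally show ?thesis .
qed

text \<open>Two vectors spanning a positive definite plane have a nontrivial combination that is
  orthogonal to the only eigenvector of positive eigenvalue.\<close>

lemma not_two_positive:
  fixes n :: nat and U :: "nat \<Rightarrow> nat \<Rightarrow> complex"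
  assumes b: "\<And>j k. j < n \<Longrightarrow> k < n \<Longrightarrow> complex_of_real (b j k) = (\<Sum>i<n. of_real (m i) * U j i * cnj (U k i))"
    and m: "\<And>i. i < n \<Longrightarrow> i \<noteq> l \<Longrightarrow> m i \<le> 0" and sym: "\<And>j k. b j k = b k j"
  shows "\<not> two_positive {..<n} b"
proof
  assume "two_positive {..<n} b"
  then obtain x y where xy: "bform {..<n} b x y = 0" and pos: "bform {..<n} b x x > 0" "bform {..<n} b y y > 0"
    unfolding two_positive_def by blast
  have yx: "bform {..<n} b y x = 0"
    using xy unfolding bform_def by (subst sum.swap) (simp add: sym mult_ac)
  define p where "p z = (\<Sum>j<n. complex_of_real (z j) * U j l)" for z :: "nat \<Rightarrow> real"
  \<comment> \<open>The coefficients solve one linear equation in two unknowns; if both values of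
    \<open>p\<close> vanish, every pair works and 1, 1 is a nonzero choice.\<close>
  define \<alpha> \<beta> where "\<alpha> = (if p x = 0 \<and> p y = 0 then 1 else p y)" and "\<beta> = (if p x = 0 \<and> p y = 0 then 1 else - p x)"
  have ab: "\<alpha> * p x + \<beta> * p y = 0" "\<alpha> \<noteq> 0 \<or> \<beta> \<noteq> 0" by (auto simp: \<alpha>_def \<beta>_def)
  define z where "z j = \<alpha> * of_real (x j) + \<beta> * of_real (y j)" for j
  have zl: "(\<Sum>j<n. z j * U j l) = 0"
    using ab(1) by (simp add: z_def p_def sum_distrib_left sum.distrib algebra_simps)
  have expand: "(\<Sum>j<n. \<Sum>k<n. z j * of_real (b j k) * cnj (z k)) =
      of_real (\<Sum>i<n. m i * (cmod (\<Sum>j<n. z j * U j i))\<^sup>2)"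
    by (rule hermitian_form_expansion[OF b])
  have zz: "z j * of_real (b j k) * cnj (z k) = \<alpha> * cnj \<alpha> * of_real (x j * b j k * x k) +
      \<alpha> * cnj \<beta> * of_real (x j * b j k * y k) + \<beta> * cnj \<alpha> * of_real (y j * b j k * x k) +
      \<beta> * cnj \<beta> * of_real (y j * b j k * y k)" for j k
    by (simp add: z_def algebra_simps)
  have "(\<Sum>j<n. \<Sum>k<n. z j * of_real (b j k) * cnj (z k)) =
      \<alpha> * cnj \<alpha> * of_real (bform {..<n} b x x) + \<alpha> * cnj \<beta> * of_real (bform {..<n} b x y) +
      \<beta> * cnj \<alpha> * of_real (bform {..<n} b y x) + \<beta> * cnj \<beta> * of_real (bform {..<n} b y y)"
    by (simp only: zz bform_def of_real_sum sum_distrib_left sum.distrib)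
  also have "\<dots> = of_real ((cmod \<alpha>)\<^sup>2 * bform {..<n} b x x + (cmod \<beta>)\<^sup>2 * bform {..<n} b y y)"
    by (simp only: xy yx complex_norm_square of_real_mult of_real_add of_real_0 mult_zero_right add_0_right)
  finally have "complex_of_real (\<Sum>i<n. m i * (cmod (\<Sum>j<n. z j * U j i))\<^sup>2) =
      of_real ((cmod \<alpha>)\<^sup>2 * bform {..<n} b x x + (cmod \<beta>)\<^sup>2 * bform {..<n} b y y)"
    unfolding expand .
  then have "(\<Sum>i<n. m i * (cmod (\<Sum>j<n. z j * U j i))\<^sup>2) =
      (cmod \<alpha>)\<^sup>2 * bform {..<n} b x x + (cmod \<beta>)\<^sup>2 * bform {..<n} b y y"
    by (simp only: of_real_eq_iff)
  moreover have "(\<Sum>i<n. m i * (cmod (\<Sum>j<n. z j * U j i))\<^sup>2) \<le> 0"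
  proof (rule sum_nonpos)
    fix i assume "i \<in> {..<n}"
    then show "m i * (cmod (\<Sum>j<n. z j * U j i))\<^sup>2 \<le> 0"
      using zl m[of i] by (cases "i = l") (auto intro: mult_nonpos_nonneg)
  qed
  moreover have "(cmod \<alpha>)\<^sup>2 * bform {..<n} b x x + (cmod \<beta>)\<^sup>2 * bform {..<n} b y y > 0"
    using ab(2) pos by (auto intro: add_pos_nonneg add_nonneg_pos)
  ultimately show False by simp
qed

section \<open>Traces of powers and the count of exceptional eigenvalues\<close>

text \<open>Orthonormal columns collapse the double sum, so matrices diagonalized by the same
  \<open>U\<close> multiply eigenvalue by eigenvalue. This yields the square of the matrix and then
  its cube.\<close>

lemma spectral_product:
  fixes n :: nat and U :: "nat \<Rightarrow> nat \<Rightarrow> complex"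
  assumes U: "\<And>i l. i < n \<Longrightarrow> l < n \<Longrightarrow> (\<Sum>j<n. cnj (U j i) * U j l) = (if i = l then 1 else (0 :: complex))"
  shows "(\<Sum>k<n. (\<Sum>i<n. p i * U j i * cnj (U k i)) * (\<Sum>i<n. q i * U k i * cnj (U l i))) =
    (\<Sum>i<n. p i * q i * U j i * cnj (U l i))"
proof -
  have "(\<Sum>k<n. (\<Sum>i<n. p i * U j i * cnj (U k i)) * (\<Sum>i<n. q i * U k i * cnj (U l i))) =
      (\<Sum>k<n. \<Sum>i<n. \<Sum>h<n. p i * U j i * q h * cnj (U l h) * (cnj (U k i) * U k h))"
    by (simp add: sum_product mult_ac)
  also have "\<dots> = (\<Sum>i<n. \<Sum>k<n. \<Sum>h<n. p i * U j i * q h * cnj (U l h) * (cnj (U k i) * U k h))"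
    by (rule sum.swap)
  also have "\<dots> = (\<Sum>i<n. \<Sum>h<n. \<Sum>k<n. p i * U j i * q h * cnj (U l h) * (cnj (U k i) * U k h))"
    by (rule sum.cong[OF refl], rule sum.swap)
  also have "\<dots> = (\<Sum>i<n. \<Sum>h<n. if i = h then p i * U j i * q h * cnj (U l h) else 0)"
    by (intro sum.cong refl) (simp add: sum_distrib_left[symmetric] U)
  finally show ?thesis by (simp add: mult_ac)
qed

lemma spectral_trace:
  fixes n :: nat and U :: "nat \<Rightarrow> nat \<Rightarrow> complex"
  assumes U: "\<And>i l. i < n \<Longrightarrow> l < n \<Longrightarrow> (\<Sum>j<n. cnj (U j i) * U j l) = (if i = l then 1 else (0 :: complex))"
  shows "(\<Sum>j<n. \<Sum>i<n. p i * U j i * cnj (U j i)) = (\<Sum>i<n. p i)"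
proof -
  have "(\<Sum>j<n. \<Sum>i<n. p i * U j i * cnj (U j i)) = (\<Sum>i<n. p i * (\<Sum>j<n. cnj (U j i) * U j i))"
    by (subst sum.swap) (simp add: sum_distrib_left mult_ac)
  then show ?thesis by (simp add: U)
qed

lemma symmetric_spectrum_facts:
  fixes a :: "nat \<Rightarrow> nat \<Rightarrow> real" and n :: nat
  assumes sym: "\<And>j k. a j k = a k j"
  defines "P \<equiv> proots (char_poly (mat n n (\<lambda>(j, k). complex_of_real (a j k))))"
  shows "size P = n"
    "complex_of_real (\<Sum>j<n. \<Sum>k<n. a j k * a k j) = (\<Sum>x\<in>#P. x ^ 2)"
    "complex_of_real (\<Sum>j<n. \<Sum>l<n. \<Sum>k<n. a j k * a k l * a l j) = (\<Sum>x\<in>#P. x ^ 3)"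
    "size {#x \<in># P. x \<noteq> 1 \<and> x \<noteq> -1#} \<le> 2 \<Longrightarrow>
      (\<not> two_positive {..<n} (shift 1 a) \<and> \<not> two_positive {..<n} (shift (-1) a)) \<or>
      (\<forall>x. bform {..<n} (shift 1 a) x x \<le> 0) \<or> (\<forall>x. bform {..<n} (shift (-1) a) x x \<le> 0)"
proof -
  obtain es :: "real list" and U where es: "length es = n" "mset (map complex_of_real es) = P"
    and a: "\<And>j k. j < n \<Longrightarrow> k < n \<Longrightarrow> complex_of_real (a j k) = (\<Sum>i<n. of_real (es ! i) * U j i * cnj (U k i))"
    and U1: "\<And>j k. j < n \<Longrightarrow> k < n \<Longrightarrow> (\<Sum>i<n. U j i * cnj (U k i)) = (if j = k then 1 else 0)"
    and U2: "\<And>i l. i < n \<Longrightarrow> l < n \<Longrightarrow> (\<Sum>j<n. cnj (U j i) * U j l) = (if i = l then 1 else 0)"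
    using symmetric_spectral_decomposition[where a = a and n = n, OF sym, folded P_def] by auto
  show "size P = n" using es by (metis length_map size_mset)
  have sumP: "(\<Sum>x\<in>#P. f x) = (\<Sum>i<n. f (complex_of_real (es ! i)))" for f :: "complex \<Rightarrow> complex"
  proof -
    have "(\<Sum>x\<in>#P. f x) = sum_list (map f (map complex_of_real es))"
      unfolding es(2)[symmetric] by (metis mset_map sum_mset_sum_list)
    then show ?thesis by (simp add: sum_list_sum_nth es(1) atLeast0LessThan)
  qed
  have sq: "(\<Sum>k<n. complex_of_real (a j k) * of_real (a k l)) = (\<Sum>i<n. of_real (es ! i) ^ 2 * U j i * cnj (U l i))"
    if "j < n" "l < n" for j l
    using spectral_product[OF U2, where p = "\<lambda>i. of_real (es ! i)" and q = "\<lambda>i. of_real (es ! i)"]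
    by (simp add: a that power2_eq_square)
  have "complex_of_real (\<Sum>j<n. \<Sum>k<n. a j k * a k j) = (\<Sum>j<n. \<Sum>i<n. of_real (es ! i) ^ 2 * U j i * cnj (U j i))"
    using sq by simp
  also have "\<dots> = (\<Sum>x\<in>#P. x ^ 2)" unfolding sumP by (rule spectral_trace[OF U2])
  finally show "complex_of_real (\<Sum>j<n. \<Sum>k<n. a j k * a k j) = (\<Sum>x\<in>#P. x ^ 2)" .
  have "complex_of_real (\<Sum>j<n. \<Sum>l<n. \<Sum>k<n. a j k * a k l * a l j) =
      (\<Sum>j<n. \<Sum>l<n. (\<Sum>k<n. complex_of_real (a j k) * of_real (a k l)) * of_real (a l j))"
    by (simp add: sum_distrib_right)
  also have "\<dots> = (\<Sum>j<n. \<Sum>l<n. (\<Sum>i<n. of_real (es ! i) ^ 2 * U j i * cnj (U l i)) *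
       (\<Sum>i<n. of_real (es ! i) * U l i * cnj (U j i)))"
    by (rule sum.cong[OF refl], rule sum.cong[OF refl], rule arg_cong2[of _ _ _ _ "(*)"],
        rule sq, simp, simp, rule a, simp, simp)
  also have "\<dots> = (\<Sum>j<n. \<Sum>i<n. of_real (es ! i) ^ 2 * of_real (es ! i) * U j i * cnj (U j i))"
    using spectral_product[OF U2, where p = "\<lambda>i. of_real (es ! i) ^ 2" and q = "\<lambda>i. of_real (es ! i)"]
    by simp
  also have "\<dots> = (\<Sum>x\<in>#P. x ^ 3)"
    unfolding sumP power3_eq_cube power2_eq_square by (rule spectral_trace[OF U2])
  finally show "complex_of_real (\<Sum>j<n. \<Sum>l<n. \<Sum>k<n. a j k * a k l * a l j) = (\<Sum>x\<in>#P. x ^ 3)" .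
  \<comment> \<open>Subtracting the identity keeps the eigenvectors and only shifts the
    weights.\<close>
  have sh: "complex_of_real (shift c a j k) = (\<Sum>i<n. of_real (c * es ! i - 1) * U j i * cnj (U k i))"
    if "j < n" "k < n" for c j k
  proof -
    have "(\<Sum>i<n. of_real (c * es ! i - 1) * U j i * cnj (U k i)) =
        of_real c * (\<Sum>i<n. of_real (es ! i) * U j i * cnj (U k i)) - (\<Sum>i<n. U j i * cnj (U k i))"
      by (simp add: sum_distrib_left sum_subtractf algebra_simps)
    then show ?thesis by (simp add: a[OF that, symmetric] U1[OF that] shift_def)
  qed
  have shsym: "shift c a j k = shift c a k j" for c j k
    by (simp add: shift_def sym)
  have nonpos: "bform {..<n} (shift c a) x x \<le> 0" if "\<And>i. i < n \<Longrightarrow> c * es ! i - 1 \<le> 0" for c x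
    by (rule bform_nonpos[where m = "\<lambda>i. c * es ! i - 1" and U = U]) (simp_all only: sh that)
  have one_pos: "\<not> two_positive {..<n} (shift c a)"
    if "\<And>i. i < n \<Longrightarrow> i \<noteq> l \<Longrightarrow> c * es ! i - 1 \<le> 0" for c l
    by (rule not_two_positive[where m = "\<lambda>i. c * es ! i - 1" and U = U and l = l],
        rule sh, assumption+, rule that, assumption+, rule shsym)
  assume "size {#x \<in># P. x \<noteq> 1 \<and> x \<noteq> -1#} \<le> 2"
  then have "length (filter (\<lambda>x. x \<noteq> 1 \<and> x \<noteq> -1) (map complex_of_real es)) \<le> 2"
    unfolding es(2)[symmetric] by (metis mset_filter size_mset)
  moreover have "complex_of_real x = -1 \<longleftrightarrow> x = -1" for x
    by (metis of_real_1 of_real_eq_iff of_real_minus)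
  ultimately have card: "card {i. i < n \<and> es ! i \<noteq> 1 \<and> es ! i \<noteq> -1} \<le> 2"
    by (simp add: length_filter_conv_card filter_map o_def es(1))
  \<comment> \<open>Indices in \<open>p\<close> and \<open>q\<close> belong to eigenvalues other
    than 1 and -1, so together there are at most two: one of the sets is empty or each has at most
    one element.\<close>
  define p q where "p = {i. i < n \<and> es ! i > 1}" and "q = {i. i < n \<and> es ! i < -1}"
  have fin: "finite p" "finite q" by (simp_all add: p_def q_def)
  have "card p + card q = card (p \<union> q)"
    using fin by (intro card_Un_disjoint[symmetric]) (auto simp: p_def q_def)
  also have "\<dots> \<le> card {i. i < n \<and> es ! i \<noteq> 1 \<and> es ! i \<noteq> -1}"
    by (intro card_mono) (auto simp: p_def q_def)
  finally have "card p + card q \<le> 2" using card by simp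
  then have "card p = 0 \<or> card q = 0 \<or> card p \<le> 1 \<and> card q \<le> 1" by linarith
  then consider "p = {}" | "q = {}" | "card p \<le> 1" "card q \<le> 1" using fin by auto
  then show "(\<not> two_positive {..<n} (shift 1 a) \<and> \<not> two_positive {..<n} (shift (-1) a)) \<or>
      (\<forall>x. bform {..<n} (shift 1 a) x x \<le> 0) \<or> (\<forall>x. bform {..<n} (shift (-1) a) x x \<le> 0)"
  proof cases
    case 1
    then have "1 * es ! i - 1 \<le> 0" if "i < n" for i using that by (force simp: p_def)
    then show ?thesis using nonpos by blast
  next
    case 2
    then have "-1 * es ! i - 1 \<le> 0" if "i < n" for i using that by (force simp: q_def)
    then show ?thesis using nonpos by blast
  next
    case 3
    have sub: "\<exists>k. t \<subseteq> {k}" if "finite t" "card t \<le> 1" for t :: "nat set"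
    proof (cases "t = {}")
      case False
      then obtain k where "k \<in> t" by blast
      then have "t \<subseteq> {k}" using that card_le_Suc0_iff_eq[OF that(1)] by auto
      then show ?thesis by blast
    qed simp
    obtain k l where kl: "p \<subseteq> {k}" "q \<subseteq> {l}"
      using sub[OF fin(1) 3(1)] sub[OF fin(2) 3(2)] by blast
    then have "1 * es ! i - 1 \<le> 0" if "i < n" "i \<noteq> k" for i using that by (force simp: p_def)
    moreover have "-1 * es ! i - 1 \<le> 0" if "i < n" "i \<noteq> l" for i using kl that by (force simp: q_def)
    ultimately show ?thesis using one_pos by blast
  qed
qed

section \<open>Signed complete graphs\<close>

definition radj :: "'a sgraph \<Rightarrow> 'a \<Rightarrow> 'a \<Rightarrow> real" where
  "radj G u v = real_of_int (adj G u v)"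

lemma radj_sym: "radj G u v = radj G v u"
  by (simp add: radj_def adj_def insert_commute)

lemma radj_diag:
  assumes "signed_graph G"
  shows "radj G u u = 0"
proof -
  have "{u} \<notin> edges G" using assms by (auto simp: signed_graph_def all_pairs_def)
  then show ?thesis by (simp add: radj_def adj_def)
qed

lemma radj_values:
  assumes "signed_graph G"
  shows "radj G u v \<in> {-1, 0, 1}" "radj G u v \<noteq> 0 \<longleftrightarrow> {u, v} \<in> edges G"
  using assms by (auto simp: signed_graph_def radj_def adj_def)

text \<open>The matrix facts are carried over along an enumeration of the vertices. Pulling vectors
  back from vertices to indices suffices for the last claim, since each alternative is universal
  over vectors.\<close>

lemma sg_spectrum_facts:
  assumes G: "signed_graph G"
  shows "size (sg_spectrum G) = card (verts G)"
    "complex_of_real (\<Sum>u\<in>verts G. \<Sum>v\<in>verts G. radj G u v * radj G v u) = (\<Sum>x\<in>#sg_spectrum G. x ^ 2)"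
    "complex_of_real (\<Sum>u\<in>verts G. \<Sum>w\<in>verts G. \<Sum>v\<in>verts G. radj G u v * radj G v w * radj G w u) =
      (\<Sum>x\<in>#sg_spectrum G. x ^ 3)"
    "size {#x \<in># sg_spectrum G. x \<noteq> 1 \<and> x \<noteq> -1#} \<le> 2 \<Longrightarrow>
      (\<not> two_positive (verts G) (shift 1 (radj G)) \<and> \<not> two_positive (verts G) (shift (-1) (radj G))) \<or>
      (\<forall>x. bform (verts G) (shift 1 (radj G)) x x \<le> 0) \<or> (\<forall>x. bform (verts G) (shift (-1) (radj G)) x x \<le> 0)"
proof -
  obtain vs where vs: "distinct vs" "set vs = verts G"
    using G finite_distinct_list[of "verts G"] by (auto simp: signed_graph_def)
  define n where "n = length vs"
  define a where "a j k = radj G (vs ! j) (vs ! k)" for j k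
  have sym: "a j k = a k j" for j k by (simp add: a_def radj_sym)
  have spec: "sg_spectrum G = proots (char_poly (mat n n (\<lambda>(j, k). complex_of_real (a j k))))"
    using sg_spectrum_eq[OF vs] by (simp add: sadj_mat_def n_def a_def radj_def)
  note facts = symmetric_spectrum_facts[of a n, OF sym, folded spec]
  have sumV: "sum f (verts G) = (\<Sum>i<n. f (vs ! i))" for f :: "'a \<Rightarrow> real"
    using sum.reindex_bij_betw[OF bij_betw_nth[OF vs(1) refl refl], of f] vs(2) by (simp add: n_def)
  show "size (sg_spectrum G) = card (verts G)"
    using facts(1) distinct_card[OF vs(1)] by (simp add: vs(2) n_def)
  show "complex_of_real (\<Sum>u\<in>verts G. \<Sum>v\<in>verts G. radj G u v * radj G v u) = (\<Sum>x\<in>#sg_spectrum G. x ^ 2)"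
    using facts(2) unfolding a_def sumV .
  show "complex_of_real (\<Sum>u\<in>verts G. \<Sum>w\<in>verts G. \<Sum>v\<in>verts G. radj G u v * radj G v w * radj G w u) =
      (\<Sum>x\<in>#sg_spectrum G. x ^ 3)"
    using facts(3) unfolding a_def sumV .
  have "shift c (radj G) (vs ! j) (vs ! k) = shift c a j k" if "j < n" "k < n" for c j k
    using that nth_eq_iff_index_eq[OF vs(1)] by (simp add: shift_def a_def n_def)
  then have bf: "bform (verts G) (shift c (radj G)) x y =
      bform {..<n} (shift c a) (\<lambda>i. x (vs ! i)) (\<lambda>i. y (vs ! i))" for c x y
    unfolding bform_def sumV by simp
  assume "size {#x \<in># sg_spectrum G. x \<noteq> 1 \<and> x \<noteq> -1#} \<le> 2"
  from facts(4)[OF this]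
  show "(\<not> two_positive (verts G) (shift 1 (radj G)) \<and> \<not> two_positive (verts G) (shift (-1) (radj G))) \<or>
      (\<forall>x. bform (verts G) (shift 1 (radj G)) x x \<le> 0) \<or> (\<forall>x. bform (verts G) (shift (-1) (radj G)) x x \<le> 0)"
    unfolding two_positive_def bf by blast
qed

text \<open>The trace of the squared matrix counts ordered adjacent pairs. It is bounded termwise by
  the count of ordered pairs of distinct vertices, and equality of the sums forces equality in every
  term.\<close>

lemma signed_complete_graph_iff:
  assumes "signed_graph G"
  shows "signed_complete_graph G \<longleftrightarrow>
    (\<Sum>u\<in>verts G. \<Sum>v\<in>verts G. radj G u v * radj G v u) = real (card (verts G)) * (real (card (verts G)) - 1)"
proof -
  let ?V = "verts G" and ?f = "\<lambda>(u, v). radj G u v * radj G v u" and ?g = "\<lambda>(u, v). if u = v then 0 else 1 :: real"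
  have fin: "finite ?V" using assms by (simp add: signed_graph_def)
  have "sum ?g (?V \<times> ?V) = (\<Sum>u\<in>?V. \<Sum>v\<in>?V. 1 - (if u = v then 1 else 0))"
    unfolding sum.cartesian_product by (intro sum.cong) auto
  also have "\<dots> = real (card ?V) * (real (card ?V) - 1)"
    using fin by (simp add: sum_subtractf algebra_simps)
  finally have g: "sum ?g (?V \<times> ?V) = real (card ?V) * (real (card ?V) - 1)" .
  have le: "?f e \<le> ?g e" for e
  proof (cases e)
    case (Pair u v)
    then show ?thesis
      using radj_values(1)[OF assms, of u v] radj_diag[OF assms, of u] radj_sym[of G u v] by auto
  qed
  have pt: "?f (u, v) = ?g (u, v) \<longleftrightarrow> u = v \<or> {u, v} \<in> edges G" for u v
  proof (cases "u = v")
    case True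
    then show ?thesis using radj_diag[OF assms, of u] by simp
  next
    case False
    have "radj G u v * radj G u v = 1 \<longleftrightarrow> {u, v} \<in> edges G"
      using radj_values[OF assms, of u v] by auto
    then show ?thesis using False radj_sym[of G v u] by simp
  qed
  have "sum ?f (?V \<times> ?V) = sum ?g (?V \<times> ?V) \<longleftrightarrow> (\<forall>e\<in>?V \<times> ?V. ?f e = ?g e)"
  proof
    assume eq: "sum ?f (?V \<times> ?V) = sum ?g (?V \<times> ?V)"
    show "\<forall>e\<in>?V \<times> ?V. ?f e = ?g e"
      using sum_mono_inv[OF eq le] fin by blast
  next
    assume "\<forall>e\<in>?V \<times> ?V. ?f e = ?g e"
    then show "sum ?f (?V \<times> ?V) = sum ?g (?V \<times> ?V)" by (intro sum.cong[OF refl]) blast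
  qed
  also have "\<dots> \<longleftrightarrow> (\<forall>u\<in>?V. \<forall>v\<in>?V. u = v \<or> {u, v} \<in> edges G)"
    using pt by blast
  also have "\<dots> \<longleftrightarrow> all_pairs ?V \<subseteq> edges G"
  proof
    assume adj: "\<forall>u\<in>?V. \<forall>v\<in>?V. u = v \<or> {u, v} \<in> edges G"
    show "all_pairs ?V \<subseteq> edges G"
    proof
      fix e assume "e \<in> all_pairs ?V"
      then obtain u v where "e = {u, v}" "u \<noteq> v" "u \<in> ?V" "v \<in> ?V"
        by (auto simp: all_pairs_def card_2_iff)
      then show "e \<in> edges G" using adj by blast
    qed
  next
    assume "all_pairs ?V \<subseteq> edges G"
    moreover have "{u, v} \<in> all_pairs ?V" if "u \<in> ?V" "v \<in> ?V" "u \<noteq> v" for u v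
      using that by (simp add: all_pairs_def)
    ultimately show "\<forall>u\<in>?V. \<forall>v\<in>?V. u = v \<or> {u, v} \<in> edges G" by blast
  qed
  also have "\<dots> \<longleftrightarrow> signed_complete_graph G"
    using assms by (auto simp: signed_complete_graph_def signed_graph_def)
  finally show ?thesis unfolding g by (simp add: sum.cartesian_product)
qed

lemma signed_complete_graph_form:
  assumes G: "signed_complete_graph G" and "size {#x \<in># sg_spectrum G. x \<noteq> 1 \<and> x \<noteq> -1#} \<le> 2"
  shows "\<exists>S s. negative_clique_form (verts G) (radj G) S s \<and>
    (if card (verts G) < 2 then S = {} else S \<noteq> {} \<and> S \<noteq> verts G)"
proof -
  have sg: "signed_graph G" and fin: "finite (verts G)"
    using G by (simp_all add: signed_complete_graph_def signed_graph_def)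
  have "radj G x y = 1 \<or> radj G x y = -1" if "x \<in> verts G" "y \<in> verts G" "x \<noteq> y" for x y
    using radj_values[OF sg, of x y] that G by (auto simp: signed_complete_graph_def all_pairs_def)
  then obtain S s where "negative_clique_form (verts G) (radj G) S s"
    using negative_clique_form_exists[OF fin radj_sym radj_diag[OF sg] _ sg_spectrum_facts(4)[OF sg assms(2)]]
    by blast
  then show ?thesis by (rule negative_clique_form_proper[OF _ fin])
qed

text \<open>Any bijection that maps \<open>T\<close> to \<open>S\<close> and complement to
  complement matches the clique parts; the two switchings are then reconciled by one switching of
  \<open>H\<close>.\<close>

lemma negative_clique_form_switching_isomorphic:
  assumes G: "signed_complete_graph G" and H: "signed_complete_graph H"
    and nG: "negative_clique_form (verts G) (radj G) S s"
    and nH: "negative_clique_form (verts H) (radj H) T t"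
    and card: "card (verts H) = card (verts G)" "card T = card S"
  shows "switching_isomorphic H G"
proof -
  have fin: "finite (verts G)" "finite (verts H)"
    using G H by (simp_all add: signed_complete_graph_def signed_graph_def)
  have S: "S \<subseteq> verts G" and T: "T \<subseteq> verts H"
    and s: "\<And>u. s u = 1 \<or> s u = -1" and t: "\<And>u. t u = 1 \<or> t u = -1"
    using nG nH by (auto simp: negative_clique_form_def)
  have fST: "finite S" "finite T" using S T fin finite_subset by blast+
  obtain g where g: "bij_betw g T S" using finite_same_card_bij[OF fST(2,1) card(2)] by blast
  have "card (verts H - T) = card (verts G - S)"
    using card fST S T by (simp add: card_Diff_subset)
  then obtain h where h: "bij_betw h (verts H - T) (verts G - S)"
    using finite_same_card_bij[of "verts H - T" "verts G - S"] fin by blast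
  define f where "f u = (if u \<in> T then g u else h u)" for u
  have "bij_betw f (T \<union> (verts H - T)) (S \<union> (verts G - S))"
    unfolding f_def by (rule bij_betw_disjoint_Un[OF g h]) auto
  then have f: "bij_betw f (verts H) (verts G)" using S T by (simp add: Un_absorb1)
  have fT: "f u \<in> S \<longleftrightarrow> u \<in> T" if "u \<in> verts H" for u
    using that bij_betwE[OF g] bij_betwE[OF h] by (auto simp: f_def)
  have inj: "inj_on f (verts H)" and im: "f ` verts H = verts G"
    using f by (auto simp: bij_betw_def)
  \<comment> \<open>A product of signs is -1 exactly where they disagree, so switching at
    \<open>X\<close> turns \<open>t\<close> into the pullback of \<open>s\<close> along
    \<open>f\<close>.\<close>
  define X where "X = {u \<in> verts H. t u * s (f u) = -1}"
  have "edges G = (\<lambda>e. f ` e) ` edges H"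
  proof -
    have "(\<lambda>e. f ` e) ` all_pairs (verts H) = all_pairs (verts G)"
    proof (intro equalityI subsetI)
      fix e assume "e \<in> (\<lambda>e. f ` e) ` all_pairs (verts H)"
      then obtain d where d: "d \<subseteq> verts H" "card d = 2" "e = f ` d" by (auto simp: all_pairs_def)
      then show "e \<in> all_pairs (verts G)"
        using im card_image[OF inj_on_subset[OF inj d(1)]] by (auto simp: all_pairs_def)
    next
      fix e assume e: "e \<in> all_pairs (verts G)"
      then have "e \<subseteq> f ` verts H" unfolding im by (simp add: all_pairs_def)
      then obtain d where d: "d \<subseteq> verts H" "e = f ` d" unfolding subset_image_iff by blast
      then have "card d = 2"
        using e inj card_image[OF inj_on_subset[OF inj d(1)]] by (simp add: all_pairs_def)
      then show "e \<in> (\<lambda>e. f ` e) ` all_pairs (verts H)" using d by (auto simp: all_pairs_def)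
    qed
    then show ?thesis using G H by (simp add: signed_complete_graph_def)
  qed
  moreover have "sgn_of G (f ` e) = sgn_of (switch X H) e" if e: "e \<in> edges H" for e
  proof -
    obtain u v where uv: "e = {u, v}" "u \<noteq> v" "u \<in> verts H" "v \<in> verts H"
      using e H by (auto simp: signed_complete_graph_def all_pairs_def card_2_iff)
    have fuv: "f u \<in> verts G" "f v \<in> verts G" "f u \<noteq> f v"
      using uv im inj by (auto dest: inj_onD)
    then have "{f u, f v} \<in> edges G" using G by (simp add: signed_complete_graph_def all_pairs_def)
    then have G1: "real_of_int (sgn_of G {f u, f v}) = s (f u) * s (f v) * (if u \<in> T \<and> v \<in> T then -1 else 1)"
      using nG fuv fT uv unfolding negative_clique_form_def radj_def adj_def by force
    have H1: "real_of_int (sgn_of H {u, v}) = t u * t v * (if u \<in> T \<and> v \<in> T then -1 else 1)"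
      using nH uv e unfolding negative_clique_form_def radj_def adj_def by force
    have mem: "w \<in> X \<longleftrightarrow> t w \<noteq> s (f w)" if "w \<in> verts H" for w
      using s[of "f w"] t[of w] that by (auto simp: X_def)
    have sw: "sgn_of (switch X H) e = (if (u \<in> X) \<noteq> (v \<in> X) then - sgn_of H {u, v} else sgn_of H {u, v})"
      using uv by (auto simp: switch_def)
    have "real_of_int (sgn_of (switch X H) e) = real_of_int (sgn_of G {f u, f v})"
      unfolding sw G1 using H1 mem[OF uv(3)] mem[OF uv(4)] s[of "f u"] t[of u] s[of "f v"] t[of v]
      by (cases "u \<in> X"; cases "v \<in> X") auto
    then show ?thesis using uv by simp
  qed
  moreover have "verts (switch X H) = verts H" "edges (switch X H) = edges H" by (simp_all add: switch_def)
  ultimately have "sg_isomorphic (switch X H) G"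
    unfolding sg_isomorphic_def using f by (intro exI[of _ f]) auto
  then show ?thesis unfolding switching_isomorphic_def by (intro exI[of _ X]) (auto simp: X_def)
qed

theorem theorem6p1:
  fixes G :: "'a sgraph" and H :: "'b sgraph"
  assumes "signed_complete_graph G"
    and "size (filter_mset (\<lambda>x. x \<noteq> 1 \<and> x \<noteq> -1) (sg_spectrum G)) \<le> 2"
    and "signed_graph H"
    and "sg_spectrum H = sg_spectrum G"
  shows "switching_isomorphic H G"
proof -
  have sG: "signed_graph G" using assms(1) by (simp add: signed_complete_graph_def)
  note fG = sg_spectrum_facts[OF sG] and fH = sg_spectrum_facts[OF assms(3), unfolded assms(4)]
  have fin: "finite (verts G)" "finite (verts H)" using sG assms(3) by (simp_all add: signed_graph_def)
  have n: "card (verts H) = card (verts G)" using fG(1) fH(1) by simp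
  have "(\<Sum>u\<in>verts H. \<Sum>v\<in>verts H. radj H u v * radj H v u) =
      (\<Sum>u\<in>verts G. \<Sum>v\<in>verts G. radj G u v * radj G v u)"
    using trans[OF fH(2) fG(2)[symmetric]] unfolding of_real_eq_iff .
  then have cH: "signed_complete_graph H"
    using assms(1) n by (simp add: signed_complete_graph_iff[OF sG] signed_complete_graph_iff[OF assms(3)])
  obtain S s where S: "negative_clique_form (verts G) (radj G) S s"
    "if card (verts G) < 2 then S = {} else S \<noteq> {} \<and> S \<noteq> verts G"
    using signed_complete_graph_form[OF assms(1,2)] by blast
  obtain T t where T: "negative_clique_form (verts H) (radj H) T t"
    "if card (verts G) < 2 then T = {} else T \<noteq> {} \<and> T \<noteq> verts H"
    using signed_complete_graph_form[OF cH] assms(2,4) n by metis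
  have "card T = card S"
  proof (cases "card (verts G) < 2")
    case True
    then show ?thesis using S T by simp
  next
    case False
    define N where "N = real (card (verts G))"
    define cub where "cub q = (N - 2 * q) * (2 * q * (N - q) + (N - 1) * (N - 2))" for q
    \<comment> \<open>The type variable stays generic because the bound is applied to the vertex
      sets of \<open>G\<close> and \<open>H\<close>, which have different types.\<close>
    have bounds: "1 \<le> real (card W) \<and> real (card W) \<le> N - 1"
      if "W \<subseteq> V" "W \<noteq> {}" "W \<noteq> V" "finite V" "card V = card (verts G)" for W V :: "'c set"
    proof -
      have "card W < card V" using that by (intro psubset_card_mono) auto
      moreover have "card W \<noteq> 0" using that finite_subset by fastforce
      ultimately show ?thesis using that(5) by (simp add: N_def)
    qed
    have bS: "1 \<le> real (card S) \<and> real (card S) \<le> N - 1"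
      using S False fin bounds[of S "verts G"] by (simp add: negative_clique_form_def)
    have bT: "1 \<le> real (card T) \<and> real (card T) \<le> N - 1"
      using T False fin n bounds[of T "verts H"] by (simp add: negative_clique_form_def)
    have "cub (real (card T)) = cub (real (card S))"
      using trans[OF fH(3) fG(3)[symmetric]]
      unfolding of_real_eq_iff cubic_trace_negative_clique_form[OF fin(1) S(1) radj_diag[OF sG]]
        cubic_trace_negative_clique_form[OF fin(2) T(1) radj_diag[OF assms(3)]] cub_def N_def n .
    moreover have "cub r < cub q" if "1 \<le> q" "q < r" "r \<le> N - 1" for q r
      unfolding cub_def using cubic_trace_strict[of N q r] that by simp
    \<comment> \<open>Both sizes lie in the range where \<open>cub\<close> is strictly decreasing,
      so equal cubic traces force equal sizes.\<close>
    ultimately have "real (card S) = real (card T)"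
      using bS bT by (cases "real (card S)" "real (card T)" rule: linorder_cases) fastforce+
    then show ?thesis by simp
  qed
  then show ?thesis by (rule negative_clique_form_switching_isomorphic[OF assms(1) cH S(1) T(1) n])
qed

end
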